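(* Let $\Omega\subset\mathbb{R}^N$ be open and bounded. For every $h>0$ the functional $J_h(\cdot,\Omega):L^1(\Omega)\to[0,+\infty]$ is convex and belongs to $GC(\Omega)$. Moreover, there exist constants $C_2>C_1>0$ such that for any open sets $A,B$ with $A\subset\subset B\subset\subset\Omega$, if $h$ is small enough, then for every $u\in V_h(\Omega)$ $$C_1|Du|(A)\le J_h(u,B)\le C_2|Du|(\Omega).$$
   Context: Let $N\ge1$, let $\Sigma\subset\mathbb{Z}^N$ be a finite set, and let $F:\{0,1\}^\Sigma\to[0,+\infty)$ be submodular, i.e. $F(u\wedge v)+F(u\vee v)\le F(u)+F(v)$ for all $u,v\in\{0,1\}^\Sigma$ (componentwise min and max), with $F(0)=F(\chi_\Sigma)=0$ ($\chi_\Sigma$ is the all-ones vector). $F$ is extended to all $u\in\mathbb{R}^\Sigma$ by $F(u)=\int_{-\infty}^{+\infty}F(\chi_{\{u>s\}})\,ds$, where $\{u>s\}=\{y\in\Sigma:u(y)>s\}$. Coercivity assumption: $\Sigma$ contains $0$ and the canonical basis $(e_i)_{i=1}^N$ of $\mathbb{R}^N$, and there is $c>0$ with $F(u)\ge c\sum_{i=1}^N|u(e_i)-u(0)|$ for all $u\in\mathbb{R}^\Sigma$. For $h>0$ and $x\in h\mathbb{Z}^N$, $Q_x^h:=x+h[0,1[^N$. $V_h$ is the space of functions $u:\mathbb{R}^N\to\mathbb{R}$ with $u=\sum_{x\in h\mathbb{Z}^N}u(x)\chi_{Q_x^h}$, and for an open set $A$, $V_h(A)$ is the set of restrictions to $A$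 of functions in $V_h$. $I^h(A)$ is the set of $x\in\mathbb{R}^N$ such that $x+h\Sigma\subset A$, and for such $x$, $u[x+h\Sigma]$ is the vector $(u(x+hy))_{y\in\Sigma}\in\mathbb{R}^\Sigma$. For a bounded open set $A$, $J_h(u,A)=h^{N-1}\sum_{x\in I^h(A)\cap h\mathbb{Z}^N}F(u[x+h\Sigma])$ if $u\in V_h(A)$, and $J_h(u,A)=+\infty$ if $u\in L^1(A)\setminus V_h(A)$; functions on $\Omega$ are restricted to $A\subset\Omega$ when writing $J_h(u,A)$. $|Du|(A)$ is the total variation of $u$ in $A$. $A\subset\subset B$ means $\overline A$ is compact and contained in $B$. $GC(\Omega)$ denotes the class of proper (not identically $+\infty$) functionals $J:L^1(\Omega)\to[0,+\infty]$ such that for every $u\in L^1(\Omega)$, $J(u)=\int_{-\infty}^{+\infty}J(\chi_{\{u>s\}})\,ds$, with the convention $J(u)=+\infty$ if $s\mapsto J(\chi_{\{u>s\}})$ is not measurable. *)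

theory Defs
  imports "HOL-Analysis.Analysis"
begin

text \<open>Vectors in \<open>X\<^sup>S\<close>, for a finite \<open>S \<subseteq> \<int>\<^sup>N\<close> and \<open>X = {0,1}\<close> or \<open>X = \<real>\<close>, are the extensional
  functions \<open>S \<rightarrow>\<^sub>E X\<close>; hence the \<open>restrict\<close> in the definitions below.\<close>

abbreviation cube :: "(int^'n) set \<Rightarrow> ((int^'n) \<Rightarrow> real) set" where
  "cube S \<equiv> S \<rightarrow>\<^sub>E {0, 1}"

definition superlevel :: "(int^'n) set \<Rightarrow> ((int^'n) \<Rightarrow> real) \<Rightarrow> real \<Rightarrow> (int^'n) \<Rightarrow> real" where
  "superlevel S u s = (\<lambda>y\<in>S. if u y > s then 1 else 0)"

definition submodular_on_cube :: "(int^'n) set \<Rightarrow> (((int^'n) \<Rightarrow> real) \<Rightarrow> real) \<Rightarrow> bool" where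
  "submodular_on_cube S F \<longleftrightarrow>
     (\<forall>u\<in>cube S. \<forall>v\<in>cube S.
        F (\<lambda>y\<in>S. min (u y) (v y)) + F (\<lambda>y\<in>S. max (u y) (v y)) \<le> F u + F v)"

text \<open>The extension uses only the values of \<open>F\<close> on \<open>cube S\<close>. If \<open>F\<close> vanishes at the all-zeros and
  all-ones vectors, the integrand is a step function with bounded support.\<close>

definition extension :: "(int^'n) set \<Rightarrow> (((int^'n) \<Rightarrow> real) \<Rightarrow> real) \<Rightarrow> ((int^'n) \<Rightarrow> real) \<Rightarrow> real" where
  "extension S F u = (\<integral>s. F (superlevel S u s) \<partial>lborel)"

lemma extension_cube:
  assumes u: "u \<in> cube S"
    and F0: "F (\<lambda>y\<in>S. 0) = 0" and F1: "F (\<lambda>y\<in>S. 1) = 0"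
  shows "extension S F u = F u"
proof -
  have val: "u y = 0 \<or> u y = 1" if "y \<in> S" for y
    using u that by (auto simp: PiE_iff)
  have "F (superlevel S u s) = F u * indicator {0..<1} s" for s
  proof -
    consider "s < 0" | "0 \<le> s" "s < 1" | "1 \<le> s" by linarith
    then show ?thesis
    proof cases
      case 1
      have "superlevel S u s = (\<lambda>y\<in>S. 1)"
        unfolding superlevel_def by (rule restrict_ext) (use val 1 in force)
      then show ?thesis using 1 F1 by simp
    next
      case 2
      have "superlevel S u s = restrict u S"
        unfolding superlevel_def by (rule restrict_ext) (use val 2 in force)
      also have "\<dots> = u" using u by (simp add: PiE_restrict)
      finally show ?thesis using 2 by simp
    next
      case 3
      have "superlevel S u s = (\<lambda>y\<in>S. 0)"
        unfolding superlevel_def by (rule restrict_ext) (use val 3 in force)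
      then show ?thesis using 3 F0 by simp
    qed
  qed
  then show ?thesis by (simp add: extension_def)
qed

definition coercive :: "(int^'n) set \<Rightarrow> (((int^'n) \<Rightarrow> real) \<Rightarrow> real) \<Rightarrow> bool" where
  "coercive S F \<longleftrightarrow>
     0 \<in> S \<and> (\<forall>i. axis i 1 \<in> S) \<and>
     (\<exists>c>0. \<forall>u \<in> S \<rightarrow>\<^sub>E UNIV. extension S F u \<ge> c * (\<Sum>i\<in>UNIV. \<bar>u (axis i 1) - u 0\<bar>))"

definition vec_of_int :: "int^'n \<Rightarrow> real^'n" where
  "vec_of_int y = (\<chi> i. real_of_int (y $ i))"

definition lattice :: "real \<Rightarrow> (real^'n) set" where
  "lattice h = range (\<lambda>y. h *\<^sub>R vec_of_int y)"

definition cell :: "real \<Rightarrow> real^'n \<Rightarrow> (real^'n) set" where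
  "cell h x = {x + h *\<^sub>R t | t. \<forall>i. 0 \<le> t $ i \<and> t $ i < 1}"

definition V :: "real \<Rightarrow> (real^'n \<Rightarrow> real) set" where
  "V h = {u. \<forall>z. u z = (\<Sum>\<^sub>\<infinity>x\<in>lattice h. u x * indicator (cell h x) z)}"

text \<open>Functions on \<open>A\<close> are total functions of which only the values on \<open>A\<close> matter.\<close>

definition V_on :: "real \<Rightarrow> (real^'n) set \<Rightarrow> (real^'n \<Rightarrow> real) set" where
  "V_on h A = {u. \<exists>v\<in>V h. \<forall>x\<in>A. u x = v x}"

definition ae_eq_on :: "(real^'n) set \<Rightarrow> (real^'n \<Rightarrow> real) \<Rightarrow> (real^'n \<Rightarrow> real) \<Rightarrow> bool" where
  "ae_eq_on A u v \<longleftrightarrow> (AE x in lebesgue. x \<in> A \<longrightarrow> u x = v x)"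

definition inner_nodes :: "(int^'n) set \<Rightarrow> real \<Rightarrow> (real^'n) set \<Rightarrow> (real^'n) set" where
  "inner_nodes S h A = {x. \<forall>y\<in>S. x + h *\<^sub>R vec_of_int y \<in> A}"

definition patch :: "(int^'n) set \<Rightarrow> real \<Rightarrow> (real^'n \<Rightarrow> real) \<Rightarrow> real^'n \<Rightarrow> (int^'n) \<Rightarrow> real" where
  "patch S h u x = (\<lambda>y\<in>S. u (x + h *\<^sub>R vec_of_int y))"

definition discrete_sum ::
  "(int^'n) set \<Rightarrow> (((int^'n) \<Rightarrow> real) \<Rightarrow> real) \<Rightarrow> real \<Rightarrow> (real^'n \<Rightarrow> real) \<Rightarrow> (real^'n) set \<Rightarrow> real" where
  "discrete_sum S F h u A =
     h ^ (CARD('n) - 1) * (\<Sum>x \<in> inner_nodes S h A \<inter> lattice h. extension S F (patch S h u x))"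

text \<open>An element of \<open>L\<^sup>1(A)\<close> is an almost-everywhere class, whereas \<open>discrete_sum\<close> uses point values.
  The functional \<open>J\<^sub>h(u,A)\<close> is therefore evaluated at the representative of \<open>u\<close> in \<open>V\<^sub>h(A)\<close>, which
  for open \<open>A\<close> is unique on \<open>A\<close>: see \<open>V_ae_eq_imp_eq\<close> and \<open>J_V_on\<close> below.\<close>

definition J ::
  "(int^'n) set \<Rightarrow> (((int^'n) \<Rightarrow> real) \<Rightarrow> real) \<Rightarrow> real \<Rightarrow> (real^'n \<Rightarrow> real) \<Rightarrow> (real^'n) set \<Rightarrow> ennreal" where
  "J S F h u A =
     (if \<exists>v\<in>V_on h A. ae_eq_on A u v
      then ennreal (discrete_sum S F h (SOME v. v \<in> V_on h A \<and> ae_eq_on A u v) A)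
      else \<infinity>)"

lemma cell_iff:
  assumes "h > 0"
  shows "z \<in> cell h x \<longleftrightarrow> (\<forall>i. x $ i \<le> z $ i \<and> z $ i < x $ i + h)"
proof
  assume "z \<in> cell h x"
  then show "\<forall>i. x $ i \<le> z $ i \<and> z $ i < x $ i + h"
    using assms by (auto simp: cell_def)
next
  assume R: "\<forall>i. x $ i \<le> z $ i \<and> z $ i < x $ i + h"
  have "z = x + h *\<^sub>R ((1/h) *\<^sub>R (z - x))" using assms by simp
  moreover have "\<forall>i. 0 \<le> ((1/h) *\<^sub>R (z - x)) $ i \<and> ((1/h) *\<^sub>R (z - x)) $ i < 1"
    using R assms by (auto simp: field_simps)
  ultimately show "z \<in> cell h x" unfolding cell_def by blast
qed

lemma cell_ex1:
  fixes z :: "real^'n"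
  assumes "h > 0"
  shows "\<exists>!x. x \<in> lattice h \<and> z \<in> cell h x"
proof -
  have scale: "h * k \<le> a \<and> a < h * k + h \<longleftrightarrow> k \<le> a / h \<and> a / h < k + 1" for k a :: real
    using assms by (simp add: pos_le_divide_eq pos_divide_less_eq algebra_simps)
  have iff: "z \<in> cell h (h *\<^sub>R vec_of_int y) \<longleftrightarrow> y = (\<chi> i. \<lfloor>z $ i / h\<rfloor>)" for y
  proof -
    have "z \<in> cell h (h *\<^sub>R vec_of_int y) \<longleftrightarrow>
        (\<forall>i. real_of_int (y $ i) \<le> z $ i / h \<and> z $ i / h < real_of_int (y $ i) + 1)"
      by (simp add: cell_iff[OF assms] vec_of_int_def scale)
    also have "\<dots> \<longleftrightarrow> (\<forall>i. \<lfloor>z $ i / h\<rfloor> = y $ i)"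
      by (simp only: floor_eq_iff)
    finally show ?thesis by (auto simp: vec_eq_iff)
  qed
  then show ?thesis unfolding lattice_def by (auto simp: image_iff)
qed

lemma V_eq_on_cell:
  assumes "h > 0" "u \<in> V h" "x \<in> lattice h" "z \<in> cell h x"
  shows "u z = u x"
proof -
  have "x' \<notin> lattice h \<or> z \<notin> cell h x'" if "x' \<noteq> x" for x'
    using cell_ex1[OF assms(1), of z] assms(3,4) that by blast
  then have eq: "(\<Sum>\<^sub>\<infinity>x\<in>lattice h. u x * indicator (cell h x) z)
      = (\<Sum>\<^sub>\<infinity>x'\<in>{x}. u x' * indicator (cell h x') z)"
    using assms(3) by (intro infsum_cong_neutral) auto
  have "u z = (\<Sum>\<^sub>\<infinity>x\<in>lattice h. u x * indicator (cell h x) z)"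
    using assms(2) unfolding V_def by blast
  also note eq
  also have "(\<Sum>\<^sub>\<infinity>x'\<in>{x}. u x' * indicator (cell h x') z) = u x"
    using assms(4) by simp
  finally show ?thesis .
qed

lemma V_ae_eq_imp_eq:
  fixes A :: "(real^'n) set"
  assumes h: "h > 0" and A: "open A" and v: "v \<in> V h" and w: "w \<in> V h"
    and ae: "ae_eq_on A v w" and z: "z \<in> A"
  shows "v z = w z"
proof -
  obtain x where x: "x \<in> lattice h" "z \<in> cell h x" using cell_ex1[OF h, of z] by blast
  obtain e where e: "e > 0" "ball z e \<subseteq> A" using A z open_contains_ball by blast
  define b :: "real^'n" where "b = x + (\<chi> i. h)"
  have zb: "z $ i < b $ i" "x $ i \<le> z $ i" for i
    using x(2) h by (auto simp: cell_iff b_def)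
  have "z \<in> cbox x b" using zb by (auto simp: mem_box_cart less_imp_le)
  moreover have "box x b \<noteq> {}"
    using h by (auto simp: interval_ne_empty_cart b_def)
  ultimately have "z \<in> closure (box x b)" by (simp add: closure_box)
  then have "box x b \<inter> ball z e \<noteq> {}"
    using e(1) by (meson centre_in_ball closure_iff_nhds_not_empty open_ball order_refl)
  moreover have "open (box x b \<inter> ball z e)" by blast
  ultimately have "\<not> negligible (box x b \<inter> ball z e)" using open_not_negligible by blast
  then obtain z' where z': "z' \<in> box x b \<inter> ball z e" "v z' = w z'"
  proof -
    have "\<exists>z' \<in> box x b \<inter> ball z e. v z' = w z'"
    proof (rule ccontr)
      assume "\<not> ?thesis"
      then have *: "\<not> (z' \<in> A \<longrightarrow> v z' = w z')" if "z' \<in> box x b \<inter> ball z e" for z'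
        using that e(2) by blast
      obtain N where N: "{x \<in> space lebesgue. \<not> (x \<in> A \<longrightarrow> v x = w x)} \<subseteq> N" "N \<in> null_sets lebesgue"
        using ae unfolding ae_eq_on_def eventually_ae_filter by blast
      then have "box x b \<inter> ball z e \<subseteq> N" using * by auto
      moreover have "negligible N" using N(2) by (simp add: negligible_iff_null_sets)
      ultimately show False
        using negligible_subset \<open>\<not> negligible (box x b \<inter> ball z e)\<close> by blast
    qed
    then show ?thesis using that by blast
  qed
  then have "z' \<in> cell h x" using h by (auto simp: cell_iff mem_box_cart b_def less_imp_le)
  then show ?thesis
    using V_eq_on_cell[OF h v x(1)] V_eq_on_cell[OF h w x(1)] x(2) z'(2) by metis
qed

lemma J_V_on:
  fixes A :: "(real^'n) set"
  assumes h: "h > 0" and A: "open A" and u: "u \<in> V_on h A"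
  shows "J S F h u A = ennreal (discrete_sum S F h u A)"
proof -
  let ?P = "\<lambda>v. v \<in> V_on h A \<and> ae_eq_on A u v"
  define v where "v = (SOME v. ?P v)"
  have Pu: "?P u" using u by (simp add: ae_eq_on_def)
  then have Pv: "?P v" unfolding v_def by (rule someI[where P = ?P])
  obtain u' where u': "u' \<in> V h" "\<And>x. x \<in> A \<Longrightarrow> u x = u' x"
    using u by (auto simp: V_on_def)
  obtain v' where v': "v' \<in> V h" "\<And>x. x \<in> A \<Longrightarrow> v x = v' x"
    using Pv by (auto simp: V_on_def)
  have "ae_eq_on A u' v'"
    using Pv unfolding ae_eq_on_def by (auto elim!: eventually_mono simp: u'(2) v'(2))
  then have eq: "v x = u x" if "x \<in> A" for x
    using V_ae_eq_imp_eq[OF h A u'(1) v'(1) _ that] u'(2) v'(2) that by simp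
  have "patch S h v x = patch S h u x" if "x \<in> inner_nodes S h A" for x
    unfolding patch_def using that by (intro restrict_ext eq) (auto simp: inner_nodes_def)
  then have "discrete_sum S F h v A = discrete_sum S F h u A"
    unfolding discrete_sum_def by (intro arg_cong2[where f="(*)"] sum.cong) auto
  then show ?thesis using Pu unfolding J_def v_def by auto
qed

definition L1 :: "(real^'n) set \<Rightarrow> (real^'n \<Rightarrow> real) set" where
  "L1 A = {u. u absolutely_integrable_on A}"

definition L1_functional :: "(real^'n) set \<Rightarrow> ((real^'n \<Rightarrow> real) \<Rightarrow> ennreal) \<Rightarrow> bool" where
  "L1_functional A G \<longleftrightarrow> (\<forall>u\<in>L1 A. \<forall>v\<in>L1 A. ae_eq_on A u v \<longrightarrow> G u = G v)"

definition convex_L1 :: "(real^'n) set \<Rightarrow> ((real^'n \<Rightarrow> real) \<Rightarrow> ennreal) \<Rightarrow> bool" where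
  "convex_L1 A G \<longleftrightarrow>
     (\<forall>u\<in>L1 A. \<forall>v\<in>L1 A. \<forall>t\<in>{0..1}.
        G (\<lambda>x. (1 - t) * u x + t * v x) \<le> ennreal (1 - t) * G u + ennreal t * G v)"

definition GC :: "(real^'n) set \<Rightarrow> ((real^'n \<Rightarrow> real) \<Rightarrow> ennreal) set" where
  "GC A = {G. L1_functional A G \<and> (\<exists>u\<in>L1 A. G u \<noteq> \<infinity>) \<and>
     (\<forall>u\<in>L1 A. G u =
        (if (\<lambda>s. G (indicator {x. u x > s})) \<in> borel_measurable lebesgue
         then \<integral>\<^sup>+ s. G (indicator {x. u x > s}) \<partial>lebesgue
         else \<infinity>))}"

definition test_field :: "(real^'n) set \<Rightarrow> (real^'n \<Rightarrow> real^'n) \<Rightarrow> bool" where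
  "test_field A \<phi> \<longleftrightarrow>
     (\<forall>x. \<phi> differentiable (at x)) \<and> continuous_on UNIV (\<lambda>x. jacobian \<phi> (at x)) \<and>
     compact (closure {x. \<phi> x \<noteq> 0}) \<and> closure {x. \<phi> x \<noteq> 0} \<subseteq> A \<and>
     (\<forall>x. norm (\<phi> x) \<le> 1)"

definition divergence :: "(real^'n \<Rightarrow> real^'n) \<Rightarrow> real^'n \<Rightarrow> real" where
  "divergence \<phi> x = trace (jacobian \<phi> (at x))"

text \<open>\<open>ennreal\<close> truncates negative integrals to \<open>0\<close>, which does not change the supremum because
  \<open>\<phi> = 0\<close> is a test field.\<close>

definition total_variation :: "(real^'n \<Rightarrow> real) \<Rightarrow> (real^'n) set \<Rightarrow> ennreal" where
  "total_variation u A =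
     (SUP \<phi>\<in>{\<phi>. test_field A \<phi>}. ennreal (LINT x:A|lebesgue. u x * divergence \<phi> x))"

definition compactly_inside :: "'a::topological_space set \<Rightarrow> 'a set \<Rightarrow> bool" (infix "\<subset>\<subset>" 50) where
  "A \<subset>\<subset> B \<longleftrightarrow> compact (closure A) \<and> closure A \<subseteq> B"

end

theory Submission
  imports Defs
begin

text \<open>Edmonds' greedy algorithm gives the extension of \<open>F\<close> a subgradient at every point, so the
  extension is convex, and with it \<open>J\<^sub>h\<close>. On \<open>V\<^sub>h\<close> the coarea formula is the definition of the
  extension. A function outside \<open>V\<^sub>h\<close> has infinite energy, and so do its superlevel sets for a set of
  levels of positive measure, since otherwise the function could be recovered from a countable
  dense set of levels whose superlevel sets are unions of cells.

  Both bounds compare with the sum of the jumps \<open>|u(x + h e\<^sub>i) - u(x)|\<close>, weighted by \<open>h\<^sup>N\<^sup>-\<^sup>1\<close>. The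
  integral of \<open>u\<close> against a divergence is the limit of integrals of difference quotients of \<open>u\<close>,
  and for \<open>u\<close> in \<open>V\<^sub>h\<close> these live on slabs of width \<open>t\<close> along the faces of the cells. Coercivity
  then gives the lower bound for \<open>J\<^sub>h\<close>. For the upper bound, the extension at a node is controlled by
  jumps along lattice paths, and test fields made of bumps at the centers of the faces show that
  the total variation controls the jumps.\<close>

section \<open>Convexity and bounds for the extension\<close>

text \<open>The total variation is a bare supremum over test fields, so every integral over a face
  has to be produced from volume integrals. The slab beneath a face has volume t times the area of
  the face, and the factor 1/t of the difference quotient cancels t. For the lower bound, |phi| at
  most 1 is all that is asked of a field, so the coercivity constant itself survives. For the upper
  bound a field must be exhibited. Bumps of radius h/2 are disjoint at parallel faces but overlap at
  faces of different directions. Hence each direction, and each translate of the set of nodes along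
  a lattice path, gets a field of its own, and the losses add up to a constant that depends only on
  F, Sigma and N. The sets A, B and Omega only decide how small h must be: cells that meet A must
  have inner nodes of B as their nodes, and the paths and bumps around the inner nodes of B must
  stay in Omega. They need not stay in B, which is why the upper bound sees Omega.\<close>

lemma greedy_minorant:
  fixes f :: "'a set \<Rightarrow> real" and u :: "'a \<Rightarrow> real"
  assumes "finite S"
    and "\<And>A B. A \<subseteq> S \<Longrightarrow> B \<subseteq> S \<Longrightarrow> f (A \<inter> B) + f (A \<union> B) \<le> f A + f B"
    and "f {} = 0"
  shows "\<exists>p. (\<forall>B\<subseteq>S. sum p B \<le> f B) \<and> sum p S = f S \<and>
    (\<forall>s. sum p {y \<in> S. u y > s} = f {y \<in> S. u y > s})"
  using assms(1,2)
proof (induction S rule: finite_ranking_induct[where f = "\<lambda>y. - u y"])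
  case empty
  then show ?case using assms(3) by (auto intro!: exI[of _ "\<lambda>_. 0"])
next
  case (insert m S)
  \<comment> \<open>The ranking induction does not promise that \<open>m\<close> is new, hence the
    case distinction.\<close>
  show ?case
  proof (cases "m \<in> S")
    case True
    then have eq: "insert m S = S" by (rule insert_absorb)
    show ?thesis unfolding eq by (rule insert.IH, rule insert.prems) blast+
  next
    case False
    have "f (A \<inter> B) + f (A \<union> B) \<le> f A + f B" if "A \<subseteq> S" "B \<subseteq> S" for A B
      using that by (intro insert.prems) auto
    from insert.IH[OF this]
    obtain p where p: "\<And>B. B \<subseteq> S \<Longrightarrow> sum p B \<le> f B" "sum p S = f S"
      "\<And>s. sum p {y \<in> S. u y > s} = f {y \<in> S. u y > s}"
      by blast
    \<comment> \<open>\<open>u\<close> is minimal at \<open>m\<close>, so \<open>m\<close> comes last in the greedy order and receives the last increment of \<open>f\<close>.\<close>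
    define q where "q = p(m := f (insert m S) - f S)"
    have qS: "sum q B = sum p B" if "B \<subseteq> S" for B
      unfolding q_def using that False by (intro sum.cong) auto
    \<comment> \<open>By submodularity the last increment \<open>f (insert m S) - f S\<close> is at
      most the increment of \<open>m\<close> over \<open>B - {m}\<close>.\<close>
    have q_le: "sum q B \<le> f B" if B: "B \<subseteq> insert m S" for B
    proof (cases "m \<in> B")
      case False
      then show ?thesis using p(1)[of B] qS[of B] B by (simp add: subset_insert)
    next
      case True
      have fin: "finite B" using B insert.hyps finite_subset by blast
      have "sum q B = q m + sum q (B - {m})" using True fin by (simp add: sum.remove)
      also have "\<dots> \<le> f (insert m S) - f S + f (B - {m})"
        using p(1)[of "B - {m}"] qS[of "B - {m}"] B by (auto simp: q_def)
      also have "\<dots> \<le> f B"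
      proof -
        have "B \<inter> S = B - {m}" "B \<union> S = insert m S" using B True False by auto
        then show ?thesis using insert.prems[of B S] B by (simp add: subset_insertI)
      qed
      finally show ?thesis .
    qed
    have q_all: "sum q (insert m S) = f (insert m S)"
      using insert.hyps False qS[of S] p(2) by (simp add: q_def)
    \<comment> \<open>As \<open>u\<close> is minimal at \<open>m\<close>, a superlevel set is either
      everything or avoids \<open>m\<close>.\<close>
    have "sum q {y \<in> insert m S. u y > s} = f {y \<in> insert m S. u y > s}" for s
    proof (cases "u m > s")
      case True
      then have "u y > s" if "y \<in> S" for y using insert.hyps(2)[OF that] by linarith
      then have "{y \<in> insert m S. u y > s} = insert m S" using True by auto
      then show ?thesis using q_all by simp
    next
      case False
      then have "{y \<in> insert m S. u y > s} = {y \<in> S. u y > s}" by auto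
      then show ?thesis using p(3)[of s] qS[of "{y \<in> S. u y > s}"] by auto
    qed
    then show ?thesis using q_le q_all by blast
  qed
qed

text \<open>Neither step is integrable over the whole line by itself; their difference is supported
  between \<open>a\<close> and \<open>b\<close>.\<close>

lemma step_integral:
  "integrable lborel (\<lambda>s. of_bool (s < a) - of_bool (s < b) :: real)"
  "(\<integral>s. of_bool (s < a) - of_bool (s < b) \<partial>lborel) = (a - b :: real)"
proof -
  have eq: "(\<lambda>s. of_bool (s < a) - of_bool (s < b) :: real) =
      (\<lambda>s. indicator {b..<a} s - indicator {a..<b} s)"
    by (rule ext) (auto simp: indicator_def)
  have "emeasure lborel {c..<d} = ennreal (max 0 (d - c))" for c d :: real
    by (cases "c \<le> d") (auto simp: max_def ennreal_neg)
  then have m: "emeasure lborel {c..<d} < top" "measure lborel {c..<d} = max 0 (d - c)" for c d :: real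
    by (simp_all add: measure_def ennreal_less_top)
  have "integrable lborel (\<lambda>s. indicator {c..<d} s :: real)" for c d :: real
    by (rule integrable_real_indicator) (simp_all add: m)
  then show "integrable lborel (\<lambda>s. of_bool (s < a) - of_bool (s < b) :: real)"
    "(\<integral>s. of_bool (s < a) - of_bool (s < b) \<partial>lborel) = (a - b :: real)"
    unfolding eq by (auto simp: m)
qed

text \<open>The layer-cake formula that turns a bound on levels such as
  \<open>F_superlevel_le\<close> into one by jumps.\<close>

lemma step_abs_integral:
  "integrable lborel (\<lambda>s. \<bar>of_bool (s < a) - of_bool (s < b)\<bar> :: real)"
  "(\<integral>s. \<bar>of_bool (s < a) - of_bool (s < b)\<bar> \<partial>lborel) = \<bar>a - b :: real\<bar>"
proof -
  have eq: "(\<lambda>s. \<bar>of_bool (s < a) - of_bool (s < b)\<bar> :: real) =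
      (\<lambda>s. of_bool (s < max a b) - of_bool (s < min a b))"
    by (rule ext) (auto simp: of_bool_def)
  show "integrable lborel (\<lambda>s. \<bar>of_bool (s < a) - of_bool (s < b)\<bar> :: real)"
    "(\<integral>s. \<bar>of_bool (s < a) - of_bool (s < b)\<bar> \<partial>lborel) = \<bar>a - b :: real\<bar>"
    unfolding eq by (auto simp only: step_integral)
qed

locale normalized_cube_function =
  fixes S :: "(int^'n) set" and F :: "((int^'n) \<Rightarrow> real) \<Rightarrow> real"
  assumes finite_S: "finite S"
    and nonneg: "\<And>u. u \<in> cube S \<Longrightarrow> F u \<ge> 0"
    and submodular: "submodular_on_cube S F"
    and F_zero: "F (\<lambda>y\<in>S. 0) = 0" and F_one: "F (\<lambda>y\<in>S. 1) = 0"
begin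

lemma superlevel_in_cube [simp]: "superlevel S u s \<in> cube S"
  by (auto simp: superlevel_def)

lemma finite_cube: "finite (cube S)"
  using finite_S by (intro finite_PiE) auto

lemma F_superlevel_nonneg: "F (superlevel S u s) \<ge> 0"
  by (rule nonneg) simp

lemma extension_nonneg: "extension S F u \<ge> 0"
  unfolding extension_def by (intro integral_nonneg_AE) (simp add: F_superlevel_nonneg)

definition F_max :: real where "F_max = Max (F ` cube S)"

lemma F_le_max: "u \<in> cube S \<Longrightarrow> F u \<le> F_max"
  unfolding F_max_def using finite_cube by (intro Max_ge) auto

lemma F_max_nonneg: "F_max \<ge> 0"
  using F_le_max[of "\<lambda>y\<in>S. 0"] F_zero by auto

text \<open>\<open>F\<close> vanishes at both constant vectors. At any other superlevel vector some
  node of \<open>S\<close> disagrees with the reference node, so the sum is at least 1.\<close>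

lemma F_superlevel_le:
  assumes "y\<^sub>0 \<in> S"
  shows "F (superlevel S u s) \<le> F_max * (\<Sum>y\<in>S. \<bar>of_bool (s < u y) - of_bool (s < u y\<^sub>0)\<bar>)"
proof (cases "\<forall>y\<in>S. s < u y \<longleftrightarrow> s < u y\<^sub>0")
  case True
  then have "superlevel S u s = (\<lambda>y\<in>S. 0) \<or> superlevel S u s = (\<lambda>y\<in>S. 1)"
    unfolding superlevel_def by (cases "s < u y\<^sub>0") (auto simp: restrict_def)
  then have "F (superlevel S u s) = 0" using F_zero F_one by auto
  then show ?thesis using True by simp
next
  case False
  then obtain y where y: "y \<in> S" "(s < u y) \<noteq> (s < u y\<^sub>0)" by blast
  have "1 = \<bar>of_bool (s < u y) - of_bool (s < u y\<^sub>0) :: real\<bar>" using y by auto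
  also have "\<dots> \<le> (\<Sum>y\<in>S. \<bar>of_bool (s < u y) - of_bool (s < u y\<^sub>0)\<bar>)"
    using y finite_S by (intro member_le_sum) auto
  finally have "F_max * 1 \<le> F_max * (\<Sum>y\<in>S. \<bar>of_bool (s < u y) - of_bool (s < u y\<^sub>0)\<bar>)"
    by (intro mult_left_mono F_max_nonneg)
  then show ?thesis using F_le_max[of "superlevel S u s"] by simp
qed

text \<open>\<open>F\<close> is an arbitrary function on a finite cube, so measurability comes from
  splitting by the value of the superlevel vector.\<close>

lemma F_superlevel_measurable [measurable]: "(\<lambda>s. F (superlevel S u s)) \<in> borel_measurable borel"
proof -
  have eq: "F (superlevel S u s) = (\<Sum>w\<in>cube S. F w * of_bool (\<forall>y\<in>S. (s < u y) = (w y = 1)))" for s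
  proof -
    have "(\<forall>y\<in>S. (s < u y) = (w y = 1)) \<longleftrightarrow> w = superlevel S u s" if "w \<in> cube S" for w
    proof
      assume "\<forall>y\<in>S. (s < u y) = (w y = 1)"
      then show "w = superlevel S u s"
        using that by (intro ext) (force simp: superlevel_def PiE_iff extensional_def)
    qed (auto simp: superlevel_def)
    then have "(\<Sum>w\<in>cube S. F w * of_bool (\<forall>y\<in>S. (s < u y) = (w y = 1))) =
        (\<Sum>w\<in>cube S. if w = superlevel S u s then F w else 0)"
      by (intro sum.cong) auto
    then show ?thesis using finite_cube by simp
  qed
  have [measurable]: "Measurable.pred borel (\<lambda>s. \<forall>y\<in>S. (s < u y) = (w y = (1::real)))" for w
    by (intro pred_intros_finite finite_S) measurable
  show ?thesis unfolding eq by measurable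
qed

lemma F_superlevel_integrable:
  assumes "S \<noteq> {}"
  shows "integrable lborel (\<lambda>s. F (superlevel S u s))"
proof -
  obtain y\<^sub>0 where y0: "y\<^sub>0 \<in> S" using assms by blast
  show ?thesis
  proof (rule Bochner_Integration.integrable_bound)
    show "integrable lborel (\<lambda>s. F_max * (\<Sum>y\<in>S. \<bar>of_bool (s < u y) - of_bool (s < u y\<^sub>0)\<bar>))"
      by (intro integrable_mult_right Bochner_Integration.integrable_sum step_abs_integral)
    show "(\<lambda>s. F (superlevel S u s)) \<in> borel_measurable lborel"
      using F_superlevel_measurable[of u] by simp
    show "AE s in lborel. norm (F (superlevel S u s)) \<le>
        norm (F_max * (\<Sum>y\<in>S. \<bar>of_bool (s < u y) - of_bool (s < u y\<^sub>0)\<bar>))"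
      by (intro AE_I2)
        (simp only: real_norm_def abs_of_nonneg[OF F_superlevel_nonneg] order.trans[OF F_superlevel_le[OF y0] abs_ge_self])
  qed
qed

lemma extension_le:
  assumes "y\<^sub>0 \<in> S"
  shows "extension S F u \<le> F_max * (\<Sum>y\<in>S. \<bar>u y - u y\<^sub>0\<bar>)"
proof -
  have "extension S F u \<le> (\<integral>s. F_max * (\<Sum>y\<in>S. \<bar>of_bool (s < u y) - of_bool (s < u y\<^sub>0)\<bar>) \<partial>lborel)"
    unfolding extension_def
    using assms F_superlevel_le[OF assms]
    by (intro integral_mono F_superlevel_integrable integrable_mult_right
        Bochner_Integration.integrable_sum step_abs_integral) auto
  also have "\<dots> = F_max * (\<Sum>y\<in>S. \<bar>u y - u y\<^sub>0\<bar>)"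
    by (simp add: step_abs_integral Bochner_Integration.integral_sum)
  finally show ?thesis .
qed

text \<open>\<open>greedy_minorant\<close> gives an inequality on every level of \<open>v\<close>,
  with equality on the levels of \<open>u\<close>. Integrating over the levels yields a linear
  functional below the extension that touches it at \<open>u\<close>.\<close>

lemma extension_subgradient:
  assumes "S \<noteq> {}"
  shows "\<exists>p. extension S F u = (\<Sum>y\<in>S. p y * u y) \<and> (\<forall>v. (\<Sum>y\<in>S. p y * v y) \<le> extension S F v)"
proof -
  define f where "f B = F (\<lambda>y\<in>S. of_bool (y \<in> B))" for B
  have f_sup: "F (superlevel S v s) = f {y \<in> S. v y > s}" for v s
    unfolding f_def superlevel_def by (intro arg_cong[where f = F] restrict_ext) auto
  have "f (A \<inter> B) + f (A \<union> B) \<le> f A + f B" for A B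
  proof -
    define g h :: "int^'n \<Rightarrow> real" where "g = (\<lambda>y\<in>S. of_bool (y \<in> A))" and "h = (\<lambda>y\<in>S. of_bool (y \<in> B))"
    then have "g \<in> cube S" "h \<in> cube S" by auto
    then have "F (\<lambda>y\<in>S. min (g y) (h y)) + F (\<lambda>y\<in>S. max (g y) (h y)) \<le> F g + F h"
      using submodular unfolding submodular_on_cube_def by blast
    moreover have "(\<lambda>y\<in>S. min (g y) (h y)) = (\<lambda>y\<in>S. of_bool (y \<in> A \<inter> B))"
      "(\<lambda>y\<in>S. max (g y) (h y)) = (\<lambda>y\<in>S. of_bool (y \<in> A \<union> B))"
      by (auto simp: g_def h_def intro!: restrict_ext)
    ultimately show ?thesis unfolding f_def g_def h_def by simp
  qed
  moreover have "f {} = 0" using F_zero by (simp add: f_def)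
  ultimately obtain p where p: "\<And>B. B \<subseteq> S \<Longrightarrow> sum p B \<le> f B" "sum p S = f S"
      "\<And>s. sum p {y \<in> S. u y > s} = f {y \<in> S. u y > s}"
    using greedy_minorant[OF finite_S, of f u] by blast
  have "f S = 0" using F_one unfolding f_def by (metis (mono_tags, lifting) of_bool_eq(2) restrict_ext)
  then have p0: "sum p S = 0" using p(2) by simp
  \<comment> \<open>As \<open>p\<close> has total mass \<open>0\<close>, subtracting the indicator of \<open>s < 0\<close> costs nothing and makes
     each summand integrable in \<open>s\<close>.\<close>
  have level: "sum p {y \<in> S. v y > s} = (\<Sum>y\<in>S. p y * (of_bool (s < v y) - of_bool (s < 0)))" for v s
  proof -
    have "(\<Sum>y\<in>S. p y * (of_bool (s < v y) - of_bool (s < 0))) =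
        (\<Sum>y\<in>S. p y * of_bool (s < v y)) - (\<Sum>y\<in>S. p y) * of_bool (s < 0)"
      by (simp add: algebra_simps sum_subtractf sum_distrib_left)
    also have "(\<Sum>y\<in>S. p y * of_bool (s < v y)) = sum p {y \<in> S. v y > s}"
      using finite_S by (simp add: sum.inter_filter if_distrib of_bool_def cong: if_cong)
    finally show ?thesis using p0 by simp
  qed
  have intgr: "integrable lborel (\<lambda>s. \<Sum>y\<in>S. p y * (of_bool (s < v y) - of_bool (s < 0)))"
    and intgl: "(\<integral>s. (\<Sum>y\<in>S. p y * (of_bool (s < v y) - of_bool (s < 0))) \<partial>lborel) = (\<Sum>y\<in>S. p y * v y)" for v
  proof -
    have *: "integrable lborel (\<lambda>s. p y * (of_bool (s < v y) - of_bool (s < 0)))" for y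
      by (intro integrable_mult_right step_integral)
    show "integrable lborel (\<lambda>s. \<Sum>y\<in>S. p y * (of_bool (s < v y) - of_bool (s < 0)))"
      by (intro Bochner_Integration.integrable_sum *)
    show "(\<integral>s. (\<Sum>y\<in>S. p y * (of_bool (s < v y) - of_bool (s < 0))) \<partial>lborel) = (\<Sum>y\<in>S. p y * v y)"
      by (subst Bochner_Integration.integral_sum[OF *])
        (simp only: integral_mult_right_zero step_integral diff_0_right)
  qed
  have "extension S F u = (\<Sum>y\<in>S. p y * u y)"
    unfolding extension_def f_sup by (simp only: p(3)[symmetric] level intgl)
  moreover have "(\<Sum>y\<in>S. p y * v y) \<le> extension S F v" for v
  proof -
    have "sum p {y \<in> S. v y > s} \<le> F (superlevel S v s)" for s
      unfolding f_sup by (rule p) auto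
    then have "(\<integral>s. (\<Sum>y\<in>S. p y * (of_bool (s < v y) - of_bool (s < 0))) \<partial>lborel) \<le> extension S F v"
      unfolding extension_def
      by (intro integral_mono[OF intgr F_superlevel_integrable[OF assms]]) (simp only: level)
    then show ?thesis by (simp only: intgl)
  qed
  ultimately show ?thesis by blast
qed

text \<open>The supporting functional at the convex combination is linear and lies below the
  extension at \<open>u\<close> and at \<open>v\<close>.\<close>

lemma extension_convex:
  assumes S: "S \<noteq> {}" and t: "0 \<le> t" "t \<le> 1"
  shows "extension S F (\<lambda>y\<in>S. (1 - t) * u y + t * v y) \<le> (1 - t) * extension S F u + t * extension S F v"
proof -
  obtain p where p: "extension S F (\<lambda>y\<in>S. (1 - t) * u y + t * v y) =
      (\<Sum>y\<in>S. p y * (\<lambda>y\<in>S. (1 - t) * u y + t * v y) y)"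
    "\<And>v. (\<Sum>y\<in>S. p y * v y) \<le> extension S F v"
    using extension_subgradient[OF S, of "\<lambda>y\<in>S. (1 - t) * u y + t * v y"] by blast
  have "(\<Sum>y\<in>S. p y * (\<lambda>y\<in>S. (1 - t) * u y + t * v y) y) =
      (1 - t) * (\<Sum>y\<in>S. p y * u y) + t * (\<Sum>y\<in>S. p y * v y)"
    unfolding sum_distrib_left sum.distrib[symmetric] by (intro sum.cong) (auto simp: algebra_simps)
  also have "\<dots> \<le> (1 - t) * extension S F u + t * extension S F v"
    using t p(2) by (intro add_mono mult_left_mono) auto
  finally show ?thesis using p(1) by simp
qed

end

section \<open>Functions that are constant on the cells of a lattice\<close>

text \<open>From here on cells are indexed by integer vectors, so that translations of nodes and
  finiteness of index sets become statements about \<open>int^'n\<close>.\<close>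

definition node :: "real \<Rightarrow> int^'n \<Rightarrow> real^'n" where
  "node h k = h *\<^sub>R vec_of_int k"

definition index_of :: "real \<Rightarrow> real^'n \<Rightarrow> int^'n" where
  "index_of h z = (\<chi> i. \<lfloor>z $ i / h\<rfloor>)"

lemma node_nth [simp]: "node h k $ i = h * real_of_int (k $ i)"
  by (simp add: node_def vec_of_int_def)

lemma lattice_eq: "lattice h = range (node h)"
  by (simp add: lattice_def node_def)

lemma node_add: "node h (k + y) = node h k + h *\<^sub>R vec_of_int y"
  by (simp add: vec_eq_iff vec_of_int_def algebra_simps)

lemma vec_of_int_zero [simp]: "vec_of_int 0 = 0"
  by (simp add: vec_eq_iff vec_of_int_def)

lemma index_of_eq_iff:
  assumes "h > 0"
  shows "index_of h z = k \<longleftrightarrow> (\<forall>i. h * k $ i \<le> z $ i \<and> z $ i < h * k $ i + h)"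
proof -
  have "\<lfloor>z $ i / h\<rfloor> = k $ i \<longleftrightarrow> h * k $ i \<le> z $ i \<and> z $ i < h * k $ i + h" for i
    using assms by (simp add: floor_eq_iff pos_le_divide_eq pos_divide_less_eq algebra_simps)
  then show ?thesis by (simp add: index_of_def vec_eq_iff)
qed

lemma index_of_node [simp]: "h > 0 \<Longrightarrow> index_of h (node h k) = k"
  by (simp add: index_of_eq_iff)

lemma cell_node_iff: "h > 0 \<Longrightarrow> z \<in> cell h (node h k) \<longleftrightarrow> index_of h z = k"
  by (simp add: cell_iff index_of_eq_iff)

text \<open>Each point lies in exactly one cell, so the infinite sum in \<open>V_def\<close> has a
  single possibly nonzero term. Later proofs use membership in \<open>V h\<close> in this pointwise
  form.\<close>

lemma V_iff:
  assumes h: "h > 0"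
  shows "u \<in> V h \<longleftrightarrow> (\<forall>z. u z = u (node h (index_of h z)))"
proof
  assume "u \<in> V h"
  then show "\<forall>z. u z = u (node h (index_of h z))"
    using V_eq_on_cell[OF h] cell_node_iff[OF h] by (metis lattice_eq rangeI)
next
  assume *: "\<forall>z. u z = u (node h (index_of h z))"
  have "u z = (\<Sum>\<^sub>\<infinity>x\<in>lattice h. u x * indicator (cell h x) z)" for z
  proof -
    have "(\<Sum>\<^sub>\<infinity>x\<in>lattice h. u x * indicator (cell h x) z) =
        (\<Sum>\<^sub>\<infinity>x\<in>{node h (index_of h z)}. u x * indicator (cell h x) z)"
      by (rule infsum_cong_neutral) (auto simp: lattice_eq cell_node_iff[OF h] indicator_def)
    also have "\<dots> = u (node h (index_of h z))" by (simp add: cell_node_iff[OF h])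
    also have "\<dots> = u z" using *[rule_format, of z] by (rule sym)
    finally show ?thesis by (rule sym)
  qed
  then show "u \<in> V h" unfolding V_def by blast
qed

text \<open>\<open>\<Phi>\<close> is arbitrary because both convex combinations and thresholds at a
  level are needed.\<close>

lemma V_comb:
  assumes h: "h > 0" and u: "u \<in> V h" and v: "v \<in> V h"
  shows "(\<lambda>z. \<Phi> (u z) (v z)) \<in> V h"
proof -
  have "\<Phi> (u z) (v z) = \<Phi> (u (node h (index_of h z))) (v (node h (index_of h z)))" for z
    using u v unfolding V_iff[OF h] by (intro arg_cong2[where f = \<Phi>]) blast+
  then show ?thesis unfolding V_iff[OF h] by blast
qed

lemma V_on_comb:
  assumes h: "h > 0" and u: "u \<in> V_on h A" and v: "v \<in> V_on h A"
  shows "(\<lambda>z. \<Phi> (u z) (v z)) \<in> V_on h A"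
proof -
  obtain u' v' where "u' \<in> V h" "\<forall>x\<in>A. u x = u' x" "v' \<in> V h" "\<forall>x\<in>A. v x = v' x"
    using u v unfolding V_on_def by blast
  then show ?thesis using V_comb[OF h, of u' v' \<Phi>] unfolding V_on_def by force
qed

lemma finite_int_box: "finite {k :: int^'n. \<forall>i. k $ i \<in> {a..b}}"
proof (rule finite_subset)
  show "{k :: int^'n. \<forall>i. k $ i \<in> {a..b}} \<subseteq> vec_lambda ` (UNIV \<rightarrow>\<^sub>E {a..b})"
  proof
    fix k :: "int^'n" assume "k \<in> {k. \<forall>i. k $ i \<in> {a..b}}"
    then have "($) k \<in> UNIV \<rightarrow>\<^sub>E {a..b}" by auto
    then show "k \<in> vec_lambda ` (UNIV \<rightarrow>\<^sub>E {a..b})" by (metis image_eqI vec_nth_inverse)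
  qed
  show "finite (vec_lambda ` ((UNIV :: 'n set) \<rightarrow>\<^sub>E {a..b}))"
    by (intro finite_imageI finite_PiE) auto
qed

lemma finite_node_in_bounded:
  fixes A :: "(real^'n) set"
  assumes "h > 0" "bounded A"
  shows "finite {k. node h k \<in> A}"
proof -
  obtain R where R: "\<And>x. x \<in> A \<Longrightarrow> norm x \<le> R" using assms(2) bounded_iff by blast
  have "k $ i \<in> {-\<lceil>R / h\<rceil>..\<lceil>R / h\<rceil>}" if "node h k \<in> A" for k :: "int^'n" and i
  proof -
    have "\<bar>h * k $ i\<bar> \<le> R"
      using R[OF that] component_le_norm_cart[of "node h k" i] by simp
    then have "\<bar>real_of_int (k $ i)\<bar> \<le> R / h" using assms(1) by (simp add: abs_mult field_simps)
    also have "\<dots> \<le> of_int \<lceil>R / h\<rceil>" by simp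
    finally have "\<bar>k $ i\<bar> \<le> \<lceil>R / h\<rceil>" by linarith
    then show ?thesis by auto
  qed
  then have "{k :: int^'n. node h k \<in> A} \<subseteq> {k. \<forall>i. k $ i \<in> {-\<lceil>R / h\<rceil>..\<lceil>R / h\<rceil>}}" by blast
  then show ?thesis by (rule finite_subset) (rule finite_int_box)
qed

text \<open>Only countably many exceptional null sets can be discarded at once. The good levels have
  null complement, hence are dense, and a countable dense part \<open>D\<close> of them determines
  \<open>u x\<close> as the supremum of the levels in \<open>D\<close> below it.\<close>

lemma V_on_of_superlevels:
  fixes A :: "(real^'n) set"
  assumes h: "h > 0"
    and levels: "AE s in lebesgue. \<exists>w\<in>V_on h A. ae_eq_on A (indicator {x. u x > s}) w"
  shows "\<exists>v\<in>V_on h A. ae_eq_on A u v"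
proof -
  define G where "G = {s. \<exists>w\<in>V_on h A. ae_eq_on A (indicator {x. u x > s}) w}"
  have "\<exists>s\<in>G. p < s \<and> s < q" if "p < q" for p q :: real
  proof (rule ccontr)
    assume *: "\<not> ?thesis"
    obtain N where N: "{s \<in> space lebesgue. s \<notin> G} \<subseteq> N" "N \<in> null_sets lebesgue"
      using levels unfolding G_def eventually_ae_filter by auto
    have "{p<..<q} \<subseteq> N" using * N(1) by auto
    then have "negligible {p<..<q}"
      using N(2) negligible_subset negligible_iff_null_sets by blast
    then show False
      using open_not_negligible[of "{p<..<q}"] that by auto
  qed
  then have "\<forall>r::rat\<times>rat. \<exists>s. fst r < snd r \<longrightarrow> s \<in> G \<and> of_rat (fst r) < s \<and> s < of_rat (snd r)"
    by (metis of_rat_less)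
  \<comment> \<open>One good level in each interval with rational endpoints: countably many choices
    that are still dense.\<close>
  then obtain d :: "rat \<times> rat \<Rightarrow> real"
    where d: "\<And>r. fst r < snd r \<Longrightarrow> d r \<in> G \<and> of_rat (fst r) < d r \<and> d r < of_rat (snd r)"
    by metis
  define D where "D = d ` {r. fst r < snd r}"
  have countable_D: "countable D" unfolding D_def by simp
  have dense_D: "\<exists>s\<in>D. x < s \<and> s < y" if xy: "x < y" for x y :: real
  proof -
    obtain p where p: "x < of_rat p" "of_rat p < y" using of_rat_dense[OF xy] by blast
    obtain q where q: "of_rat p < (of_rat q :: real)" "of_rat q < y" using of_rat_dense[OF p(2)] by blast
    then have pq: "fst (p, q) < snd (p, q)" by (simp add: of_rat_less)
    have "x < d (p, q)" "d (p, q) < y" using d[OF pq] p q by auto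
    then show ?thesis using pq unfolding D_def by blast
  qed
  have "\<forall>s\<in>D. \<exists>w\<in>V h. ae_eq_on A (indicator {x. u x > s}) w"
  proof
    fix s assume "s \<in> D"
    then obtain w where w: "w \<in> V_on h A" "ae_eq_on A (indicator {x. u x > s}) w"
      using d unfolding D_def G_def by blast
    then obtain w' where w': "w' \<in> V h" "\<forall>x\<in>A. w x = w' x" unfolding V_on_def by blast
    then have "ae_eq_on A (indicator {x. u x > s}) w'"
      using w(2) unfolding ae_eq_on_def by (auto elim!: eventually_mono)
    then show "\<exists>w\<in>V h. ae_eq_on A (indicator {x. u x > s}) w" using w'(1) by blast
  qed
  then obtain w where wV: "\<And>s. s \<in> D \<Longrightarrow> w s \<in> V h"
    and w: "\<And>s. s \<in> D \<Longrightarrow> ae_eq_on A (indicator {x. u x > s}) (w s)"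
    by metis
  \<comment> \<open>Where the set of levels is empty or unbounded, the supremum is an unspecified
    real. It still depends only on that set, which is the same throughout a cell.\<close>
  define v where "v z = Sup {s \<in> D. w s z = 1}" for z
  have "v \<in> V h"
  proof -
    have "v z = v (node h (index_of h z))" for z
    proof -
      have "w s z = w s (node h (index_of h z))" if "s \<in> D" for s
        using wV[OF that] unfolding V_iff[OF h] by blast
      then show ?thesis unfolding v_def by (metis (mono_tags, lifting))
    qed
    then show ?thesis unfolding V_iff[OF h] by blast
  qed
  moreover have "ae_eq_on A u v"
  proof -
    have "AE x in lebesgue. \<forall>s\<in>D. x \<in> A \<longrightarrow> indicator {x. u x > s} x = w s x"
      using w countable_D unfolding ae_eq_on_def by (subst AE_ball_countable) auto
    then have "AE x in lebesgue. x \<in> A \<longrightarrow> u x = v x"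
    proof (rule eventually_mono, intro impI)
      fix x assume *: "\<forall>s\<in>D. x \<in> A \<longrightarrow> indicator {x. u x > s} x = w s x" and "x \<in> A"
      then have "w s x = 1 \<longleftrightarrow> s < u x" if "s \<in> D" for s
        using that by (auto simp: indicator_def split: if_splits)
      then have eq: "{s \<in> D. w s x = 1} = {s \<in> D. s < u x}" by auto
      have "Sup {s \<in> D. s < u x} = u x"
      proof (rule cSup_eq)
        fix y assume y: "\<And>s. s \<in> {s \<in> D. s < u x} \<Longrightarrow> s \<le> y"
        show "u x \<le> y"
        proof (rule ccontr)
          assume "\<not> u x \<le> y"
          then obtain s where "s \<in> D" "y < s" "s < u x" using dense_D[of y "u x"] by auto
          then show False using y[of s] by auto
        qed
      qed auto
      then show "u x = v x" unfolding v_def eq by simp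
    qed
    then show ?thesis unfolding ae_eq_on_def .
  qed
  ultimately show ?thesis unfolding V_on_def by blast
qed

section \<open>The discrete functional\<close>

lemma ae_eq_on_sym: "ae_eq_on A u v \<Longrightarrow> ae_eq_on A v u"
  unfolding ae_eq_on_def by (auto elim!: eventually_mono)

lemma ae_eq_on_trans: "ae_eq_on A u v \<Longrightarrow> ae_eq_on A v w \<Longrightarrow> ae_eq_on A u w"
  unfolding ae_eq_on_def by (erule (1) eventually_elim2) auto

text \<open>The choice of a representative in \<open>J_def\<close> sees \<open>u\<close> only
  through the predicate \<open>ae_eq_on A u\<close>, which depends on the class alone.\<close>

lemma J_cong:
  assumes "ae_eq_on A u v"
  shows "J S F h u A = J S F h v A"
proof -
  have "ae_eq_on A u w \<longleftrightarrow> ae_eq_on A v w" for w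
    using assms ae_eq_on_sym ae_eq_on_trans by blast
  then show ?thesis unfolding J_def by simp
qed

lemma J_eq_discrete_sum:
  assumes "h > 0" "open A" "w \<in> V_on h A" "ae_eq_on A u w"
  shows "J S F h u A = ennreal (discrete_sum S F h w A)"
  using J_cong[OF assms(4)] J_V_on[OF assms(1-3)] by metis

lemma J_infinite: "\<not> (\<exists>v\<in>V_on h A. ae_eq_on A u v) \<Longrightarrow> J S F h u A = \<infinity>"
  unfolding J_def by simp

context normalized_cube_function
begin

lemma discrete_sum_nonneg: "h > 0 \<Longrightarrow> discrete_sum S F h u A \<ge> 0"
  unfolding discrete_sum_def by (intro mult_nonneg_nonneg sum_nonneg extension_nonneg) auto

lemma discrete_sum_convex:
  assumes "S \<noteq> {}" "h > 0" "0 \<le> t" "t \<le> 1"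
  shows "discrete_sum S F h (\<lambda>x. (1 - t) * u x + t * v x) A \<le>
    (1 - t) * discrete_sum S F h u A + t * discrete_sum S F h v A"
proof -
  let ?I = "inner_nodes S h A \<inter> lattice h"
  have "extension S F (patch S h (\<lambda>x. (1 - t) * u x + t * v x) x) \<le>
      (1 - t) * extension S F (patch S h u x) + t * extension S F (patch S h v x)" for x
  proof -
    have "patch S h (\<lambda>x. (1 - t) * u x + t * v x) x =
        (\<lambda>y\<in>S. (1 - t) * patch S h u x y + t * patch S h v x y)"
      unfolding patch_def by (rule restrict_ext) simp
    then show ?thesis using extension_convex[OF assms(1,3,4)] by simp
  qed
  then have "(\<Sum>x\<in>?I. extension S F (patch S h (\<lambda>x. (1 - t) * u x + t * v x) x)) \<le>
      (\<Sum>x\<in>?I. (1 - t) * extension S F (patch S h u x) + t * extension S F (patch S h v x))"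
    by (intro sum_mono)
  then have "discrete_sum S F h (\<lambda>x. (1 - t) * u x + t * v x) A \<le>
      h ^ (CARD('n) - 1) * (\<Sum>x\<in>?I. (1 - t) * extension S F (patch S h u x) + t * extension S F (patch S h v x))"
    unfolding discrete_sum_def using assms(2) by (intro mult_left_mono) auto
  also have "\<dots> = (1 - t) * discrete_sum S F h u A + t * discrete_sum S F h v A"
    unfolding discrete_sum_def by (simp only: sum.distrib sum_distrib_left[symmetric] distrib_left) (simp add: ac_simps)
  finally show ?thesis .
qed

lemma J_convex:
  assumes S: "S \<noteq> {}" and h: "h > 0" and A: "open A"
  shows "convex_L1 A (\<lambda>u. J S F h u A)"
  unfolding convex_L1_def
proof (intro ballI)
  fix u v and t :: real assume t: "t \<in> {0..1}"
  \<comment> \<open>At the endpoints a factor 0 absorbs a possible value \<open>\<infinity>\<close>,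
    as \<open>0 * \<infinity> = 0\<close> in \<open>ennreal\<close>; strictly between them an
    infinite energy of \<open>u\<close> or \<open>v\<close> makes the right-hand side
    infinite.\<close>
  consider "t = 0" | "t = 1" | "0 < t" "t < 1" using t by force
  then show "J S F h (\<lambda>x. (1 - t) * u x + t * v x) A \<le>
      ennreal (1 - t) * J S F h u A + ennreal t * J S F h v A"
  proof cases
    case 3
    show ?thesis
    proof (cases "(\<exists>u'\<in>V_on h A. ae_eq_on A u u') \<and> (\<exists>v'\<in>V_on h A. ae_eq_on A v v')")
      case True
      then obtain u' v' where u': "u' \<in> V_on h A" "ae_eq_on A u u'"
        and v': "v' \<in> V_on h A" "ae_eq_on A v v'" by blast
      have w: "(\<lambda>x. (1 - t) * u' x + t * v' x) \<in> V_on h A"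
        by (rule V_on_comb[OF h u'(1) v'(1)])
      have "ae_eq_on A (\<lambda>x. (1 - t) * u x + t * v x) (\<lambda>x. (1 - t) * u' x + t * v' x)"
        using u'(2) v'(2) unfolding ae_eq_on_def by (rule eventually_elim2) auto
      then have "J S F h (\<lambda>x. (1 - t) * u x + t * v x) A =
          ennreal (discrete_sum S F h (\<lambda>x. (1 - t) * u' x + t * v' x) A)"
        by (rule J_eq_discrete_sum[OF h A w])
      also have "\<dots> \<le> ennreal ((1 - t) * discrete_sum S F h u' A + t * discrete_sum S F h v' A)"
        using 3 by (intro ennreal_leI discrete_sum_convex S h) auto
      also have "\<dots> = ennreal (1 - t) * ennreal (discrete_sum S F h u' A) + ennreal t * ennreal (discrete_sum S F h v' A)"
        using 3 discrete_sum_nonneg[OF h] by (simp add: ennreal_plus ennreal_mult)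
      also have "\<dots> = ennreal (1 - t) * J S F h u A + ennreal t * J S F h v A"
        using J_eq_discrete_sum[OF h A u'] J_eq_discrete_sum[OF h A v'] by simp
      finally show ?thesis .
    next
      case False
      then have "J S F h u A = \<infinity> \<or> J S F h v A = \<infinity>" using J_infinite by blast
      then have "ennreal (1 - t) * J S F h u A + ennreal t * J S F h v A = \<infinity>"
        using 3 by (auto simp: ennreal_mult_top)
      then show ?thesis by (simp only: infinity_ennreal_def top_greatest)
    qed
  qed simp_all
qed

text \<open>Thresholding keeps a function constant on cells and turns each patch into a vector of
  the cube, where the extension is \<open>F\<close> itself.\<close>

lemma J_superlevel:
  assumes h: "h > 0" and A: "open A" and v: "v \<in> V_on h A" "ae_eq_on A u v"
  shows "J S F h (indicator {x. u x > s}) A =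
    ennreal (h ^ (CARD('n) - 1) * (\<Sum>x \<in> inner_nodes S h A \<inter> lattice h. F (superlevel S (patch S h v x) s)))"
proof -
  have "(indicator {x. v x > s} :: _ \<Rightarrow> real) = (\<lambda>z. of_bool (v z > s))" by (auto simp: indicator_def)
  then have iV: "indicator {x. v x > s} \<in> V_on h A"
    using V_on_comb[OF h v(1) v(1), of "\<lambda>a b. of_bool (a > s)"] by simp
  have "ae_eq_on A (indicator {x. u x > s}) (indicator {x. v x > s})"
    using v(2) unfolding ae_eq_on_def by (auto elim!: eventually_mono simp: indicator_def)
  then have "J S F h (indicator {x. u x > s}) A = ennreal (discrete_sum S F h (indicator {x. v x > s}) A)"
    by (rule J_eq_discrete_sum[OF h A iV])
  moreover have "patch S h (indicator {x. v x > s}) x = superlevel S (patch S h v x) s" for x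
    unfolding patch_def superlevel_def by (intro restrict_ext) (auto simp: indicator_def)
  then have "extension S F (patch S h (indicator {x. v x > s}) x) = F (superlevel S (patch S h v x) s)" for x
    using extension_cube[OF superlevel_in_cube F_zero F_one] by simp
  ultimately show ?thesis unfolding discrete_sum_def by simp
qed

text \<open>The sum over the nodes is exchanged with the integral over the levels; each node then
  contributes exactly the integral that defines \<open>extension\<close>.\<close>

lemma J_coarea:
  assumes S: "S \<noteq> {}" and h: "h > 0" and A: "open A" and v: "v \<in> V_on h A" "ae_eq_on A u v"
  shows "(\<lambda>s. J S F h (indicator {x. u x > s}) A) \<in> borel_measurable lebesgue"
    and "(\<integral>\<^sup>+ s. J S F h (indicator {x. u x > s}) A \<partial>lebesgue) = J S F h u A"
proof -
  let ?I = "inner_nodes S h A \<inter> lattice h"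
  let ?g = "\<lambda>s. h ^ (CARD('n) - 1) * (\<Sum>x \<in> ?I. F (superlevel S (patch S h v x) s))"
  have meas: "(\<lambda>s. ennreal (?g s)) \<in> borel_measurable lborel"
    by measurable
  then show "(\<lambda>s. J S F h (indicator {x. u x > s}) A) \<in> borel_measurable lebesgue"
    unfolding J_superlevel[OF h A v] by (intro measurable_completion)
  have intgr: "integrable lborel (\<lambda>s. F (superlevel S (patch S h v x) s))" for x
    by (rule F_superlevel_integrable[OF S])
  have "(\<integral>\<^sup>+ s. J S F h (indicator {x. u x > s}) A \<partial>lebesgue) = (\<integral>\<^sup>+ s. ennreal (?g s) \<partial>lborel)"
    unfolding J_superlevel[OF h A v] by (rule nn_integral_completion)
  also have "\<dots> = ennreal (\<integral>s. ?g s \<partial>lborel)"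
    using h F_superlevel_nonneg
    by (intro nn_integral_eq_integral integrable_mult_right Bochner_Integration.integrable_sum intgr AE_I2
        mult_nonneg_nonneg sum_nonneg) auto
  also have "(\<integral>s. ?g s \<partial>lborel) = discrete_sum S F h v A"
    unfolding discrete_sum_def extension_def by (simp add: Bochner_Integration.integral_sum[OF intgr])
  also have "ennreal \<dots> = J S F h u A" by (rule J_eq_discrete_sum[OF h A v, symmetric])
  finally show "(\<integral>\<^sup>+ s. J S F h (indicator {x. u x > s}) A \<partial>lebesgue) = J S F h u A" .
qed

lemma J_GC:
  assumes S: "S \<noteq> {}" and h: "h > 0" and A: "open A"
  shows "(\<lambda>u. J S F h u A) \<in> GC A"
  unfolding GC_def
proof (intro CollectI conjI ballI)
  show "L1_functional A (\<lambda>u. J S F h u A)" unfolding L1_functional_def using J_cong by blast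
  have "(\<lambda>x. 0) \<in> V h" unfolding V_iff[OF h] by simp
  then have "(\<lambda>x. 0) \<in> V_on h A" unfolding V_on_def by auto
  then show "\<exists>u\<in>L1 A. J S F h u A \<noteq> \<infinity>"
    using J_V_on[OF h A] by (intro bexI[of _ "\<lambda>x. 0"]) (auto simp: L1_def)
  fix u assume "u \<in> L1 A"
  show "J S F h u A = (if (\<lambda>s. J S F h (indicator {x. u x > s}) A) \<in> borel_measurable lebesgue
         then \<integral>\<^sup>+ s. J S F h (indicator {x. u x > s}) A \<partial>lebesgue else \<infinity>)"
  proof (cases "\<exists>v\<in>V_on h A. ae_eq_on A u v")
    case True
    then obtain v where v: "v \<in> V_on h A" "ae_eq_on A u v" by blast
    show ?thesis using J_coarea[OF S h A v] by simp
  next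
    \<comment> \<open>If measurability fails, the convention in \<open>GC_def\<close> already gives
      \<open>\<infinity>\<close>; only the measurable case needs an argument.\<close>
    case False
    have "(\<integral>\<^sup>+ s. J S F h (indicator {x. u x > s}) A \<partial>lebesgue) = \<infinity>"
      if meas: "(\<lambda>s. J S F h (indicator {x. u x > s}) A) \<in> borel_measurable lebesgue"
    proof (rule ccontr)
      assume "(\<integral>\<^sup>+ s. J S F h (indicator {x. u x > s}) A \<partial>lebesgue) \<noteq> \<infinity>"
      then have "AE s in lebesgue. J S F h (indicator {x. u x > s}) A \<noteq> \<infinity>"
        using nn_integral_PInf_AE[OF meas] by simp
      then have "AE s in lebesgue. \<exists>w\<in>V_on h A. ae_eq_on A (indicator {x. u x > s}) w"
        by (rule eventually_mono) (use J_infinite in blast)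
      then show False using V_on_of_superlevels[OF h] False by blast
    qed
    then show ?thesis using J_infinite[OF False] by simp
  qed
qed

end

section \<open>Difference quotients and the total variation\<close>

lemma integrable_bounded_support:
  fixes f :: "'a::euclidean_space \<Rightarrow> real"
  assumes "f \<in> borel_measurable borel" "\<And>x. \<bar>f x\<bar> \<le> M" "\<And>x. norm x > R \<Longrightarrow> f x = 0"
  shows "integrable lborel f"
proof (rule Bochner_Integration.integrable_bound)
  show "integrable lborel (\<lambda>x. M * indicator (cball 0 R) x)"
    by (intro integrable_mult_right integrable_real_indicator emeasure_lborel_cball_finite) auto
  show "AE x in lborel. norm (f x) \<le> norm (M * indicator (cball 0 R) x)"
  proof (rule AE_I2)
    fix x
    have "\<bar>f x\<bar> \<le> \<bar>M\<bar>" using assms(2)[of x] by linarith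
    then show "norm (f x) \<le> norm (M * indicator (cball 0 R) x)"
      using assms(3)[of x] by (cases "norm x > R") (auto simp: indicator_def)
  qed
qed (use assms(1) in simp)

lemma continuous_bounded_support:
  fixes g :: "'a::euclidean_space \<Rightarrow> real"
  assumes "continuous_on UNIV g" "\<And>x. norm x > R \<Longrightarrow> g x = 0"
  obtains M where "M \<ge> 0" "\<And>x. \<bar>g x\<bar> \<le> M"
proof -
  have "compact (g ` cball 0 R)"
    by (intro compact_continuous_image continuous_on_subset[OF assms(1)]) auto
  then obtain M where M: "\<forall>y\<in>g ` cball 0 R. norm y \<le> M" using compact_imp_bounded bounded_iff by blast
  have "\<bar>g x\<bar> \<le> max M 0" for x
    using M assms(2)[of x] by (cases "norm x > R") (auto simp: le_max_iff_disj)
  then show ?thesis using that[of "max M 0"] by auto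
qed

text \<open>A function in \<open>V h\<close> may be unbounded on the whole space. Boundedness on
  balls suffices against a compactly supported factor.\<close>

definition locally_bounded :: "('a::euclidean_space \<Rightarrow> real) \<Rightarrow> bool" where
  "locally_bounded w \<longleftrightarrow> (\<forall>R. \<exists>W. \<forall>x. norm x \<le> R \<longrightarrow> \<bar>w x\<bar> \<le> W)"

lemma locally_bounded_shift:
  assumes "locally_bounded w"
  shows "locally_bounded (\<lambda>z. w (z + c))"
  unfolding locally_bounded_def
proof
  fix R
  obtain W where "\<forall>x. norm x \<le> R + norm c \<longrightarrow> \<bar>w x\<bar> \<le> W"
    using assms unfolding locally_bounded_def by blast
  then have "\<forall>x. norm x \<le> R \<longrightarrow> \<bar>w (x + c)\<bar> \<le> W"
    by (meson add_right_mono norm_triangle_le)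
  then show "\<exists>W. \<forall>x. norm x \<le> R \<longrightarrow> \<bar>w (x + c)\<bar> \<le> W" by blast
qed

lemma integrable_locally_bounded_mult:
  fixes g w :: "'a::euclidean_space \<Rightarrow> real"
  assumes w: "w \<in> borel_measurable borel" "locally_bounded w"
    and g: "continuous_on UNIV g" "\<And>x. norm x > R \<Longrightarrow> g x = 0"
  shows "integrable lborel (\<lambda>z. w z * g z)"
proof -
  obtain W where W: "\<And>x. norm x \<le> R \<Longrightarrow> \<bar>w x\<bar> \<le> W"
    using w(2) unfolding locally_bounded_def by blast
  obtain M where M: "M \<ge> 0" "\<And>x. \<bar>g x\<bar> \<le> M" using continuous_bounded_support[OF g] by blast
  have "\<bar>w x * g x\<bar> \<le> \<bar>W\<bar> * M" for x
  proof (cases "norm x \<le> R")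
    case True
    then have "\<bar>w x\<bar> \<le> \<bar>W\<bar>" using W[of x] by linarith
    then show ?thesis unfolding abs_mult by (intro mult_mono M) auto
  qed (use g(2)[of x] M in auto)
  moreover have "(\<lambda>z. w z * g z) \<in> borel_measurable borel"
    using w(1) borel_measurable_continuous_onI[OF g(1)] by measurable
  ultimately show ?thesis
    by (intro integrable_bounded_support[where M = "\<bar>W\<bar> * M" and R = R]) (auto simp: g(2))
qed

text \<open>Transfers the vanishing of \<open>g\<close> outside a ball or a closed set to its
  directional derivative.\<close>

lemma line_derivative_zero:
  fixes g :: "'a::real_normed_vector \<Rightarrow> real"
  assumes "((\<lambda>t. g (x + t *\<^sub>R e)) has_real_derivative D) (at 0)" "open U" "x \<in> U"
    "\<And>y. y \<in> U \<Longrightarrow> g y = 0"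
  shows "D = 0"
proof -
  have "open ((\<lambda>t. x + t *\<^sub>R e) -` U)"
    by (intro open_vimage assms(2) continuous_intros)
  then have "((\<lambda>t. g (x + t *\<^sub>R e)) has_real_derivative 0) (at 0)"
    using assms(3,4)
    by (intro has_field_derivative_transform_within_open[OF DERIV_const[of 0]]) auto
  then show ?thesis using assms(1) DERIV_unique by blast
qed

lemma integral_translate:
  fixes f :: "'a::euclidean_space \<Rightarrow> real"
  assumes "f \<in> borel_measurable borel"
  shows "(\<integral>z. f (z + c) \<partial>lborel) = (\<integral>z. f z \<partial>lborel)"
proof -
  have "(\<integral>z. f z \<partial>lborel) = (\<integral>z. f z \<partial>distr lborel borel ((+) c))"
    by (simp add: lborel_distr_plus)
  also have "\<dots> = (\<integral>z. f (c + z) \<partial>lborel)" using assms by (intro integral_distr) auto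
  finally show ?thesis by (simp add: add.commute)
qed

text \<open>Integration by parts that differentiates only \<open>g\<close>. Translation invariance
  moves the backward quotient of \<open>g\<close> onto \<open>w\<close>, where it becomes a negated
  forward quotient, so \<open>w\<close> may jump. The mean value inequality bounds the quotients of
  \<open>g\<close> by a bound of \<open>d\<close>, and dominated convergence gives the
  limit.\<close>

lemma difference_quotient_limit:
  fixes g w d :: "'a::euclidean_space \<Rightarrow> real"
  assumes deriv: "\<And>x. ((\<lambda>t. g (x + t *\<^sub>R e)) has_real_derivative d x) (at 0)"
    and d: "continuous_on UNIV d"
    and g: "continuous_on UNIV g" "\<And>x. norm x > R \<Longrightarrow> g x = 0"
    and w: "w \<in> borel_measurable borel" "locally_bounded w"
  shows "(\<lambda>n. \<integral>z. (w z - w (z + inverse (real (Suc n)) *\<^sub>R e)) * g z / inverse (real (Suc n)) \<partial>lborel)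
    \<longlonglongrightarrow> (\<integral>z. w z * d z \<partial>lborel)"
proof -
  define t where "t n = inverse (real (Suc n))" for n
  have t: "0 < t n" "t n \<le> 1" for n by (auto simp: t_def inverse_le_1_iff)
  have d0: "d x = 0" if "norm x > R" for x
    by (rule line_derivative_zero[OF deriv, of "{x. norm x > R}"])
      (use that g(2) in \<open>auto intro!: open_Collect_less continuous_intros\<close>)
  obtain M where M: "M \<ge> 0" "\<And>x. \<bar>d x\<bar> \<le> M" using continuous_bounded_support[OF d d0] by blast
  have line: "((\<lambda>t. g (x + t *\<^sub>R e)) has_real_derivative d (x + s *\<^sub>R e)) (at s)" for x s
  proof -
    have "((\<lambda>t. g (x + (t + s) *\<^sub>R e)) has_real_derivative d (x + s *\<^sub>R e)) (at 0)"
      using deriv[of "x + s *\<^sub>R e"] by (simp add: algebra_simps)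
    then show ?thesis using DERIV_shift[of "\<lambda>t. g (x + t *\<^sub>R e)" _ 0 s] by simp
  qed
  have quot: "\<bar>g z - g (z - s *\<^sub>R e)\<bar> \<le> M * s" if "s > 0" for z s
  proof -
    have "norm (g (z + 0 *\<^sub>R e) - g (z + (-s) *\<^sub>R e)) \<le> M * norm (0 - (-s))"
      by (rule field_differentiable_bound[where S = UNIV and f = "\<lambda>t. g (z + t *\<^sub>R e)"])
        (use line M in auto)
    then show ?thesis using that by simp
  qed
  have lim: "(\<lambda>n. (g z - g (z - t n *\<^sub>R e)) / t n) \<longlonglongrightarrow> d z" for z
  proof -
    have "((\<lambda>h. (g (z + h *\<^sub>R e) - g z) / h) \<longlongrightarrow> d z) (at 0)"
      using deriv[of z] by (simp add: DERIV_def)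
    moreover have "filterlim (\<lambda>n. - t n) (at 0) sequentially"
    proof -
      have "(\<lambda>n. - t n) \<longlonglongrightarrow> - 0"
        unfolding t_def by (intro tendsto_minus LIMSEQ_inverse_real_of_nat)
      moreover have "t n \<noteq> 0" for n using t(1)[of n] by simp
      ultimately show ?thesis by (simp add: filterlim_at)
    qed
    ultimately have "(\<lambda>n. (g (z + (- t n) *\<^sub>R e) - g z) / (- t n)) \<longlonglongrightarrow> d z"
      by (rule filterlim_compose)
    moreover have "(g (z + (- t n) *\<^sub>R e) - g z) / (- t n) = (g z - g (z - t n *\<^sub>R e)) / t n" for n
      by (simp add: divide_minus_right minus_divide_left)
    ultimately show ?thesis by (simp only:)
  qed
  obtain W where W: "\<And>x. norm x \<le> R + norm e \<Longrightarrow> \<bar>w x\<bar> \<le> W"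
    using w(2) unfolding locally_bounded_def by blast
  have gm [measurable]: "g \<in> borel_measurable borel" and dm [measurable]: "d \<in> borel_measurable borel"
    and wm [measurable]: "w \<in> borel_measurable borel"
    using borel_measurable_continuous_onI g d w(1) by blast+
  \<comment> \<open>Since \<open>t n \<le> 1\<close>, all shifted supports lie in one ball, of
    radius \<open>R + norm e\<close>.\<close>
  have g_shift: "g (z - t n *\<^sub>R e) = 0" if "norm z > R + norm e" for z n
  proof (rule g(2))
    have "norm (t n *\<^sub>R e) \<le> norm e" using t[of n] by (simp add: mult_left_le_one_le)
    then show "norm (z - t n *\<^sub>R e) > R" using that norm_triangle_ineq2[of z "t n *\<^sub>R e"] by linarith
  qed
  have "(\<lambda>n. \<integral>z. w z * ((g z - g (z - t n *\<^sub>R e)) / t n) \<partial>lborel) \<longlonglongrightarrow> (\<integral>z. w z * d z \<partial>lborel)"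
  proof (rule integral_dominated_convergence[where w = "\<lambda>z. \<bar>W\<bar> * M * indicator (cball 0 (R + norm e)) z"])
    show "integrable lborel (\<lambda>z. \<bar>W\<bar> * M * indicator (cball 0 (R + norm e)) z)"
      by (intro integrable_mult_right integrable_real_indicator emeasure_lborel_cball_finite) auto
    show "AE z in lborel. (\<lambda>n. w z * ((g z - g (z - t n *\<^sub>R e)) / t n)) \<longlonglongrightarrow> w z * d z"
      by (intro AE_I2 tendsto_mult tendsto_const lim)
    show "AE z in lborel. norm (w z * ((g z - g (z - t n *\<^sub>R e)) / t n)) \<le>
        \<bar>W\<bar> * M * indicator (cball 0 (R + norm e)) z" for n
    proof (rule AE_I2)
      fix z
      show "norm (w z * ((g z - g (z - t n *\<^sub>R e)) / t n)) \<le> \<bar>W\<bar> * M * indicator (cball 0 (R + norm e)) z"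
      proof (cases "norm z \<le> R + norm e")
        case True
        then have "\<bar>w z\<bar> \<le> \<bar>W\<bar>" using W[of z] by linarith
        moreover have "\<bar>(g z - g (z - t n *\<^sub>R e)) / t n\<bar> \<le> M"
          using quot[OF t(1)[of n], of z] t(1)[of n] by (simp add: field_simps)
        ultimately have "\<bar>w z\<bar> * \<bar>(g z - g (z - t n *\<^sub>R e)) / t n\<bar> \<le> \<bar>W\<bar> * M"
          by (intro mult_mono) auto
        then show ?thesis using True by (simp add: abs_mult)
      next
        case False
        then have "norm z > R" using norm_ge_zero[of e] by linarith
        then show ?thesis using False g(2)[of z] g_shift[of z n] by simp
      qed
    qed
  qed measurable
  moreover have "(\<integral>z. w z * ((g z - g (z - t n *\<^sub>R e)) / t n) \<partial>lborel) =
      (\<integral>z. (w z - w (z + t n *\<^sub>R e)) * g z / t n \<partial>lborel)" for n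
  proof -
    have cont: "continuous_on UNIV (\<lambda>z. g (z - t n *\<^sub>R e))"
      by (rule continuous_on_compose2[OF g(1)]) (auto intro!: continuous_intros)
    have i1: "integrable lborel (\<lambda>z. w z * g z)"
      by (rule integrable_locally_bounded_mult[OF w g])
    have i2: "integrable lborel (\<lambda>z. w z * g (z - t n *\<^sub>R e))"
      by (rule integrable_locally_bounded_mult[OF w cont g_shift])
    have i3: "integrable lborel (\<lambda>z. w (z + t n *\<^sub>R e) * g z)"
      by (rule integrable_locally_bounded_mult[OF _ locally_bounded_shift[OF w(2)] g]) measurable
    have "(\<integral>z. w z * (g z - g (z - t n *\<^sub>R e)) \<partial>lborel) =
        (\<integral>z. w z * g z \<partial>lborel) - (\<integral>z. w z * g (z - t n *\<^sub>R e) \<partial>lborel)"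
      by (subst Bochner_Integration.integral_diff[OF i1 i2, symmetric]) (simp add: algebra_simps)
    also have "(\<integral>z. w z * g (z - t n *\<^sub>R e) \<partial>lborel) = (\<integral>z. w (z + t n *\<^sub>R e) * g z \<partial>lborel)"
      using integral_translate[of "\<lambda>z. w z * g (z - t n *\<^sub>R e)" "t n *\<^sub>R e"] by simp
    also have "(\<integral>z. w z * g z \<partial>lborel) - (\<integral>z. w (z + t n *\<^sub>R e) * g z \<partial>lborel) =
        (\<integral>z. (w z - w (z + t n *\<^sub>R e)) * g z \<partial>lborel)"
      by (subst Bochner_Integration.integral_diff[OF i1 i3, symmetric]) (simp add: algebra_simps)
    finally have "(\<integral>z. w z * (g z - g (z - t n *\<^sub>R e)) \<partial>lborel) / t n =
        (\<integral>z. (w z - w (z + t n *\<^sub>R e)) * g z \<partial>lborel) / t n" by simp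
    then show ?thesis by simp
  qed
  ultimately show ?thesis unfolding t_def by simp
qed

lemma test_field_zero:
  assumes "test_field A \<phi>" "x \<notin> A"
  shows "\<phi> x = 0"
  using assms closure_subset[of "{x. \<phi> x \<noteq> 0}"] unfolding test_field_def by blast

text \<open>The diagonal entries of the Jacobian are treated one coordinate at a time. The
  divergence vanishes off the support of the field, so the integral over \<open>A\<close> extends to
  the whole space and shifted points may leave \<open>A\<close>.\<close>

lemma weak_divergence_limit:
  fixes \<phi> :: "real^'n \<Rightarrow> real^'n"
  assumes \<phi>: "test_field A \<phi>" and w: "w \<in> borel_measurable borel" "locally_bounded w"
  shows "(\<lambda>n. \<Sum>i\<in>UNIV. \<integral>z. (w z - w (z + inverse (real (Suc n)) *\<^sub>R axis i 1)) * \<phi> z $ i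
      / inverse (real (Suc n)) \<partial>lborel) \<longlonglongrightarrow> (LINT x:A|lebesgue. w x * divergence \<phi> x)"
proof -
  define d where "d i x = jacobian \<phi> (at x) $ i $ i" for i x
  let ?C = "closure {x. \<phi> x \<noteq> 0}"
  have deriv: "((\<lambda>t. \<phi> (x + t *\<^sub>R axis i 1) $ i) has_real_derivative d i x) (at 0)" for i x
  proof -
    let ?D = "frechet_derivative \<phi> (at x)"
    have D: "(\<phi> has_derivative ?D) (at x)"
      using \<phi> unfolding test_field_def by (simp add: frechet_derivative_works)
    then have lin: "linear ?D" by (rule has_derivative_linear)
    have "((\<lambda>t. x + t *\<^sub>R axis i 1) has_derivative (\<lambda>t. t *\<^sub>R axis i 1)) (at 0)"
      by (auto intro!: derivative_eq_intros)
    then have "((\<lambda>t. \<phi> (x + t *\<^sub>R axis i 1)) has_derivative (\<lambda>t. ?D (t *\<^sub>R axis i 1))) (at 0)"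
      by (rule has_derivative_compose) (use D in simp)
    then have "((\<lambda>t. \<phi> (x + t *\<^sub>R axis i 1) $ i) has_derivative (\<lambda>t. ?D (t *\<^sub>R axis i 1) $ i)) (at 0)"
      by (rule bounded_linear.has_derivative[OF bounded_linear_vec_nth])
    moreover have "(\<lambda>t. ?D (t *\<^sub>R axis i 1) $ i) = (*) (d i x)"
      by (auto simp: d_def jacobian_def matrix_def linear_scale[OF lin])
    ultimately show ?thesis unfolding has_field_derivative_def by simp
  qed
  have dc: "continuous_on UNIV (d i)" for i
    unfolding d_def using \<phi> unfolding test_field_def by (auto intro!: continuous_intros)
  have "continuous_on UNIV \<phi>"
    using \<phi> unfolding test_field_def by (auto simp: continuous_on_eq_continuous_at intro!: differentiable_imp_continuous_within)
  then have gc: "continuous_on UNIV (\<lambda>x. \<phi> x $ i)" for i by (intro continuous_intros)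
  have "bounded ?C" using \<phi> unfolding test_field_def by (auto intro: compact_imp_bounded)
  then obtain R where R: "\<And>x. x \<in> ?C \<Longrightarrow> norm x \<le> R" using bounded_iff by blast
  have g0: "\<phi> x $ i = 0" if "norm x > R" for x i
  proof -
    have "x \<notin> ?C" using R[of x] that by linarith
    then have "\<phi> x = 0" using closure_subset[of "{x. \<phi> x \<noteq> 0}"] by blast
    then show ?thesis by simp
  qed
  have dC: "d i x = 0" if "x \<notin> ?C" for i x
    by (rule line_derivative_zero[OF deriv, of "- ?C"])
      (use that closure_subset[of "{x. \<phi> x \<noteq> 0}"] in \<open>auto simp: vec_eq_iff\<close>)
  have d0: "d i x = 0" if "norm x > R" for i x using dC R[of x] that by fastforce
  have div: "divergence \<phi> x = (\<Sum>i\<in>UNIV. d i x)" for x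
    by (simp add: divergence_def trace_def d_def)
  have "divergence \<phi> x = 0" if "x \<notin> A" for x
    using that dC \<phi> unfolding div test_field_def by (intro sum.neutral) auto
  then have "indicator A x *\<^sub>R (w x * divergence \<phi> x) = w x * divergence \<phi> x" for x
    by (cases "x \<in> A") auto
  then have "(\<lambda>x. indicator A x *\<^sub>R (w x * divergence \<phi> x)) = (\<lambda>x. \<Sum>i\<in>UNIV. w x * d i x)"
    by (simp add: div sum_distrib_left)
  then have "(LINT x:A|lebesgue. w x * divergence \<phi> x) = (\<integral>x. (\<Sum>i\<in>UNIV. w x * d i x) \<partial>lebesgue)"
    unfolding set_lebesgue_integral_def by simp
  also have "\<dots> = (\<integral>x. (\<Sum>i\<in>UNIV. w x * d i x) \<partial>lborel)"
    using w(1) borel_measurable_continuous_onI[OF dc] by (intro integral_completion borel_measurable_sum borel_measurable_times) auto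
  also have "\<dots> = (\<Sum>i\<in>UNIV. \<integral>x. w x * d i x \<partial>lborel)"
    by (intro Bochner_Integration.integral_sum integrable_locally_bounded_mult[OF w dc d0])
  finally show ?thesis
    by (simp only:) (intro tendsto_sum difference_quotient_limit[OF deriv dc gc g0 w])
qed

section \<open>Shifts of cellwise constant functions and the upper estimate of the total
  variation\<close>

lemma finite_index_image:
  assumes "h > 0" "bounded B"
  shows "finite (index_of h ` B)"
proof -
  obtain R where R: "\<And>x. x \<in> B \<Longrightarrow> norm x \<le> R" using assms(2) bounded_iff by blast
  have "\<lfloor>z $ i / h\<rfloor> \<in> {-\<lceil>R / h\<rceil>..\<lceil>R / h\<rceil>}" if "z \<in> B" for z i
  proof -
    have "\<bar>z $ i\<bar> \<le> R" using R[OF that] component_le_norm_cart[of z i] by linarith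
    then have "\<bar>z $ i / h\<bar> \<le> R / h" using assms(1) by (simp add: divide_right_mono)
    then have "- of_int \<lceil>R / h\<rceil> \<le> z $ i / h" "z $ i / h \<le> of_int \<lceil>R / h\<rceil>"
      using le_of_int_ceiling[of "R / h"] by linarith+
    then show ?thesis by (auto simp: le_floor_iff floor_le_iff)
  qed
  then have "index_of h ` B \<subseteq> {k. \<forall>i. k $ i \<in> {-\<lceil>R / h\<rceil>..\<lceil>R / h\<rceil>}}"
    by (auto simp: index_of_def)
  then show ?thesis by (rule finite_subset) (rule finite_int_box)
qed

lemma V_locally_bounded:
  assumes h: "h > 0" and v: "v \<in> V h"
  shows "locally_bounded v"
  unfolding locally_bounded_def
proof
  fix R
  have fin: "finite ((\<lambda>k. \<bar>v (node h k)\<bar>) ` index_of h ` cball 0 R)"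
    by (intro finite_imageI finite_index_image[OF h]) simp
  have "\<bar>v x\<bar> \<le> Max ((\<lambda>k. \<bar>v (node h k)\<bar>) ` index_of h ` cball 0 R)" if "norm x \<le> R" for x
  proof -
    have "v x = v (node h (index_of h x))" using v unfolding V_iff[OF h] by blast
    then have "\<bar>v x\<bar> \<in> (\<lambda>k. \<bar>v (node h k)\<bar>) ` index_of h ` cball 0 R" using that by force
    then show ?thesis by (rule Max_ge[OF fin])
  qed
  then show "\<exists>W. \<forall>x. norm x \<le> R \<longrightarrow> \<bar>v x\<bar> \<le> W" by blast
qed

lemma V_measurable:
  assumes h: "h > 0" and v: "v \<in> V h"
  shows "v \<in> borel_measurable borel"
proof -
  have "index_of h \<in> measurable borel (count_space UNIV)"
  proof (subst measurable_count_space_eq2_countable, intro conjI ballI)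
    fix k :: "int^'n"
    have "index_of h -` {k} \<inter> space borel = {z. \<forall>i. h * k $ i \<le> z $ i \<and> z $ i < h * k $ i + h}"
      using index_of_eq_iff[OF h] by auto
    also have "\<dots> \<in> sets borel" by measurable
    finally show "index_of h -` {k} \<inter> space borel \<in> sets borel" .
  qed auto
  then have "(\<lambda>z. v (node h (index_of h z))) \<in> borel_measurable borel"
    by (rule measurable_compose_countable[where f = "\<lambda>k z. v (node h k)", rotated]) simp
  moreover have "v = (\<lambda>z. v (node h (index_of h z)))" using v unfolding V_iff[OF h] by blast
  ultimately show ?thesis by (rule back_subst[of "\<lambda>u. u \<in> borel_measurable borel", OF _ sym])
qed

definition node_diff :: "real \<Rightarrow> (real^'n \<Rightarrow> real) \<Rightarrow> 'n \<Rightarrow> int^'n \<Rightarrow> real" where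
  "node_diff h v i k = v (node h (k + axis i 1)) - v (node h k)"

text \<open>For \<open>t \<le> h\<close> a shift by \<open>t\<close> crosses at most one face in
  direction \<open>i\<close>, and it does so exactly from the slab of width \<open>t\<close> beneath
  the upper face of the cell.\<close>

lemma V_shift:
  assumes h: "h > 0" and v: "v \<in> V h" and t: "0 < t" "t \<le> h"
  shows "v z - v (z + t *\<^sub>R axis i 1) =
    (if z $ i \<ge> h * (index_of h z $ i + 1) - t then - node_diff h v i (index_of h z) else 0)"
proof -
  define k where "k = index_of h z"
  have k: "h * k $ j \<le> z $ j" "z $ j < h * k $ j + h" for j
    using index_of_eq_iff[OF h, of z k] k_def by auto
  have eq: "v y = v (node h (index_of h y))" for y using v unfolding V_iff[OF h] by blast
  show ?thesis
  proof (cases "z $ i \<ge> h * (k $ i + 1) - t")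
    case True
    have "index_of h (z + t *\<^sub>R axis i 1) = k + axis i 1"
      unfolding index_of_eq_iff[OF h]
    proof
      fix j
      show "h * real_of_int ((k + axis i 1) $ j) \<le> (z + t *\<^sub>R axis i 1) $ j \<and>
         (z + t *\<^sub>R axis i 1) $ j < h * real_of_int ((k + axis i 1) $ j) + h"
        using k[of j] True t by (cases "j = i") (auto simp: axis_def algebra_simps)
    qed
    then show ?thesis using True eq[of z] eq[of "z + t *\<^sub>R axis i 1"]
      unfolding node_diff_def k_def[symmetric] by simp
  next
    case False
    have "index_of h (z + t *\<^sub>R axis i 1) = k"
      unfolding index_of_eq_iff[OF h]
    proof
      fix j
      show "h * real_of_int (k $ j) \<le> (z + t *\<^sub>R axis i 1) $ j \<and>
         (z + t *\<^sub>R axis i 1) $ j < h * real_of_int (k $ j) + h"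
        using k[of j] False t by (cases "j = i") (auto simp: axis_def algebra_simps)
    qed
    then show ?thesis using False eq[of z] eq[of "z + t *\<^sub>R axis i 1"]
      unfolding k_def[symmetric] by simp
  qed
qed

text \<open>The volume is linear in \<open>t\<close>, so dividing by \<open>t\<close> leaves the
  measure of a face, independent of the step of the difference quotient.\<close>

lemma content_slab:
  fixes a b :: "real^'n"
  assumes "0 \<le> r" "0 \<le> t" "b $ i - a $ i = t" "\<And>j. j \<noteq> i \<Longrightarrow> b $ j - a $ j = r"
  shows "measure lborel (cbox a b) = t * r ^ (CARD('n) - 1)"
proof -
  have "a $ j \<le> b $ j" for j using assms by (metis diff_ge_0_iff_ge)
  then have "cbox a b \<noteq> {}" by (simp add: interval_ne_empty_cart)
  then have "measure lborel (cbox a b) = (\<Prod>j\<in>UNIV. b $ j - a $ j)" by (rule content_cbox_cart)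
  also have "\<dots> = (b $ i - a $ i) * (\<Prod>j\<in>UNIV - {i}. b $ j - a $ j)"
    by (rule prod.remove) auto
  also have "(\<Prod>j\<in>UNIV - {i}. b $ j - a $ j) = (\<Prod>j\<in>UNIV - {i}. r)"
    by (rule prod.cong) (use assms(4) in auto)
  finally show ?thesis using assms(3) by (simp add: card_Diff_singleton)
qed

text \<open>Only cells with index in \<open>K\<close> matter, since the field vanishes outside
  \<open>A\<close>. On each slab the integrand is at most the jump over \<open>t\<close>, because
  the components of the field are at most 1 in absolute value, and the volume of the slab cancels
  \<open>t\<close>.\<close>

lemma total_variation_le:
  fixes A :: "(real^'n) set"
  assumes h: "h > 0" and v: "v \<in> V h" and K: "finite K" "index_of h ` A \<subseteq> K"
  shows "total_variation v A \<le> ennreal (h ^ (CARD('n) - 1) * (\<Sum>k\<in>K. \<Sum>i\<in>UNIV. \<bar>node_diff h v i k\<bar>))"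
  unfolding total_variation_def
proof (rule SUP_least, rule ennreal_leI)
  fix \<phi> :: "real^'n \<Rightarrow> real^'n" assume "\<phi> \<in> {\<phi>. test_field A \<phi>}"
  then have \<phi>: "test_field A \<phi>" by simp
  let ?c = "h ^ (CARD('n) - 1)"
  let ?I = "\<lambda>t i. \<integral>z. (v z - v (z + t *\<^sub>R axis i 1)) * \<phi> z $ i / t \<partial>lborel"
  have bound: "?I t i \<le> (\<Sum>k\<in>K. \<bar>node_diff h v i k\<bar> * ?c)" if t: "0 < t" "t \<le> h" for t i
  proof -
    define lo :: "int^'n \<Rightarrow> real^'n" where "lo k = (\<chi> j. h * k $ j + (if j = i then h - t else 0))" for k
    define hi :: "int^'n \<Rightarrow> real^'n" where "hi k = (\<chi> j. h * k $ j + h)" for k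
    have m: "measure lborel (cbox (lo k) (hi k)) = t * ?c" for k
      by (rule content_slab) (use h t in \<open>auto simp: lo_def hi_def\<close>)
    have i1: "integrable lborel (\<lambda>z. c * indicator (cbox (lo k) (hi k)) z)" for c :: real and k
      by (rule integrable_mult_right, rule integrable_real_indicator, simp, rule emeasure_lborel_cbox_finite)
    have ig: "integrable lborel (\<lambda>z. \<Sum>k\<in>K. \<bar>node_diff h v i k\<bar> / t * indicator (cbox (lo k) (hi k)) z)"
      by (intro Bochner_Integration.integrable_sum i1)
    have pw: "(v z - v (z + t *\<^sub>R axis i 1)) * \<phi> z $ i / t \<le>
        (\<Sum>k\<in>K. \<bar>node_diff h v i k\<bar> / t * indicator (cbox (lo k) (hi k)) z)" for z
    proof -
      define k where "k = index_of h z"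
      have k: "h * k $ j \<le> z $ j" "z $ j < h * k $ j + h" for j
        using index_of_eq_iff[OF h, of z k] k_def by auto
      have nn: "0 \<le> (\<Sum>k\<in>K. \<bar>node_diff h v i k\<bar> / t * indicator (cbox (lo k) (hi k)) z)"
        using t by (intro sum_nonneg) auto
      show ?thesis
      proof (cases "z \<in> A \<and> z $ i \<ge> h * (k $ i + 1) - t")
        case True
        then have kK: "k \<in> K" using K(2) k_def by blast
        have inb: "z \<in> cbox (lo k) (hi k)"
          unfolding mem_box_cart
        proof
          fix j show "lo k $ j \<le> z $ j \<and> z $ j \<le> hi k $ j"
            using k[of j] True by (cases "j = i") (auto simp: lo_def hi_def algebra_simps)
        qed
        have "\<bar>\<phi> z $ i\<bar> \<le> 1"
          using \<phi> component_le_norm_cart[of "\<phi> z" i] unfolding test_field_def by (meson order.trans)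
        then have "\<bar>node_diff h v i k\<bar> * \<bar>\<phi> z $ i\<bar> \<le> \<bar>node_diff h v i k\<bar>"
          by (simp add: mult_left_le)
        then have "\<bar>(v z - v (z + t *\<^sub>R axis i 1)) * \<phi> z $ i\<bar> \<le> \<bar>node_diff h v i k\<bar>"
          unfolding V_shift[OF h v t] k_def[symmetric] abs_mult using True by simp
        then have "(v z - v (z + t *\<^sub>R axis i 1)) * \<phi> z $ i / t \<le> \<bar>node_diff h v i k\<bar> / t"
          using t by (intro divide_right_mono) auto
        also have "\<dots> = \<bar>node_diff h v i k\<bar> / t * indicator (cbox (lo k) (hi k)) z"
          using inb by simp
        also have "\<dots> \<le> (\<Sum>k\<in>K. \<bar>node_diff h v i k\<bar> / t * indicator (cbox (lo k) (hi k)) z)"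
          using kK K(1) t by (intro member_le_sum) auto
        finally show ?thesis .
      next
        case False
        then have "(v z - v (z + t *\<^sub>R axis i 1)) * \<phi> z $ i = 0"
          using test_field_zero[OF \<phi>, of z] unfolding V_shift[OF h v t] k_def[symmetric] by auto
        then show ?thesis using nn by (simp only: div_0)
      qed
    qed
    have "?I t i \<le> (\<integral>z. (\<Sum>k\<in>K. \<bar>node_diff h v i k\<bar> / t * indicator (cbox (lo k) (hi k)) z) \<partial>lborel)"
    proof (cases "integrable lborel (\<lambda>z. (v z - v (z + t *\<^sub>R axis i 1)) * \<phi> z $ i / t)")
      case True
      then show ?thesis by (rule integral_mono[OF _ ig pw])
    next
      \<comment> \<open>A non-integrable integrand has integral 0 by convention, which is below the
        nonnegative bound.\<close>
      case False
      show ?thesis unfolding not_integrable_integral_eq[OF False]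
        using t by (intro integral_nonneg_AE AE_I2 sum_nonneg) auto
    qed
    also have "\<dots> = (\<Sum>k\<in>K. \<bar>node_diff h v i k\<bar> / t * measure lborel (cbox (lo k) (hi k)))"
      by (subst Bochner_Integration.integral_sum[OF i1]) simp
    also have "\<dots> = (\<Sum>k\<in>K. \<bar>node_diff h v i k\<bar> * ?c)"
      unfolding m using t by simp
    finally show ?thesis .
  qed
  have "eventually (\<lambda>n. inverse (real (Suc n)) \<le> h) sequentially"
    using order_tendstoD(2)[OF LIMSEQ_inverse_real_of_nat h] by (auto elim!: eventually_mono)
  then have "eventually (\<lambda>n. (\<Sum>i\<in>UNIV. ?I (inverse (real (Suc n))) i) \<le>
      (\<Sum>i\<in>UNIV. \<Sum>k\<in>K. \<bar>node_diff h v i k\<bar> * ?c)) sequentially"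
    by (rule eventually_mono) (intro sum_mono bound; simp)
  then have "(LINT x:A|lebesgue. v x * divergence \<phi> x) \<le> (\<Sum>i\<in>UNIV. \<Sum>k\<in>K. \<bar>node_diff h v i k\<bar> * ?c)"
    using tendsto_upperbound[OF weak_divergence_limit[OF \<phi> V_measurable[OF h v] V_locally_bounded[OF h v]]] by simp
  also have "\<dots> = ?c * (\<Sum>k\<in>K. \<Sum>i\<in>UNIV. \<bar>node_diff h v i k\<bar>)"
    by (subst sum.swap) (simp add: sum_distrib_left mult.commute)
  finally show "(LINT x:A|lebesgue. v x * divergence \<phi> x) \<le> ?c * (\<Sum>k\<in>K. \<Sum>i\<in>UNIV. \<bar>node_diff h v i k\<bar>)" .
qed

section \<open>Bump fields at face centers and the lower estimate of the total variation\<close>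

text \<open>The center of the common face of the cells with indices \<open>k\<close> and \<open>k + e\<^sub>i\<close>.\<close>

definition face_center :: "real \<Rightarrow> 'n \<Rightarrow> int^'n \<Rightarrow> real^'n" where
  "face_center h i k = (\<chi> j. h * (k $ j + 1/2) + (if j = i then h / 2 else 0))"

text \<open>The square of a truncated paraboloid. Squaring makes it continuously differentiable, as
  \<open>test_field\<close> demands, and the factor 4 puts the support in the ball of radius
  \<open>h / 2\<close>.\<close>

definition bump :: "real \<Rightarrow> real^'n \<Rightarrow> real^'n \<Rightarrow> real" where
  "bump h c z = (max 0 (1 - 4 / h\<^sup>2 * ((z - c) \<bullet> (z - c))))\<^sup>2"

definition bump_gradient :: "real \<Rightarrow> real^'n \<Rightarrow> real^'n \<Rightarrow> real^'n" where
  "bump_gradient h c z = (- (16 / h\<^sup>2) * max 0 (1 - 4 / h\<^sup>2 * ((z - c) \<bullet> (z - c)))) *\<^sub>R (z - c)"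

lemma bump_nonneg: "0 \<le> bump h c z"
  by (simp add: bump_def)

lemma bump_le_one: "bump h c z \<le> 1"
  unfolding bump_def by (intro power_le_one) (auto intro!: mult_nonneg_nonneg)

lemma bump_eq_zero:
  assumes "h > 0" "z \<notin> cball c (h / 2)"
  shows "bump h c z = 0"
proof -
  have "h / 2 \<le> norm (z - c)" using assms(2) by (simp add: dist_norm norm_minus_commute)
  then have "(h / 2)\<^sup>2 \<le> (norm (z - c))\<^sup>2" using assms(1) by (intro power_mono) auto
  then have "1 \<le> 4 / h\<^sup>2 * ((z - c) \<bullet> (z - c))"
    using assms(1) by (simp add: power2_norm_eq_inner power_divide field_simps)
  then show ?thesis by (simp add: bump_def)
qed

lemma bump_neq_zeroD:
  assumes "h > 0" "bump h c z \<noteq> 0"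
  shows "\<bar>z $ j - c $ j\<bar> < h / 2"
proof -
  have "4 / h\<^sup>2 * ((z - c) \<bullet> (z - c)) < 1"
    using assms(2) by (intro ccontr[of "_ < 1"]) (simp add: bump_def)
  then have "4 * ((z - c) \<bullet> (z - c)) < h\<^sup>2"
    using assms(1) by (simp add: pos_divide_less_eq)
  then have "(norm (z - c))\<^sup>2 < (h / 2)\<^sup>2"
    unfolding power2_norm_eq_inner power_divide by simp
  then have "norm (z - c) < h / 2"
    by (rule power2_less_imp_less) (use assms(1) in simp)
  then show ?thesis using component_le_norm_cart[of "z - c" j] by simp
qed

text \<open>With \<open>N = CARD('n)\<close>, the squared distance is at most
  \<open>N * (h / (4 * N))\<^sup>2 \<le> h\<^sup>2 / 16\<close>, so the bump is at least
  \<open>(3 / 4)\<^sup>2\<close>.\<close>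

lemma bump_ge_half:
  fixes z c :: "real^'n"
  assumes h: "h > 0" and near: "\<And>j. \<bar>z $ j - c $ j\<bar> \<le> h / (4 * CARD('n))"
  shows "1 / 2 \<le> bump h c z"
proof -
  have N: "CARD('n) \<ge> 1" by (simp add: Suc_leI)
  have "(z - c) \<bullet> (z - c) = (\<Sum>j\<in>UNIV. (z $ j - c $ j)\<^sup>2)"
    by (simp add: inner_vec_def power2_eq_square)
  also have "\<dots> \<le> (\<Sum>j\<in>(UNIV :: 'n set). (h / (4 * CARD('n)))\<^sup>2)"
    using near by (intro sum_mono) (simp add: abs_le_square_iff[symmetric] h less_imp_le)
  also have "\<dots> = h\<^sup>2 / (16 * CARD('n))"
    by (simp add: power2_eq_square field_simps)
  also have "\<dots> \<le> h\<^sup>2 / 16" using N by (intro divide_left_mono) auto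
  finally have "4 / h\<^sup>2 * ((z - c) \<bullet> (z - c)) \<le> 1 / 4" using h by (simp add: field_simps)
  then have "(3 / 4)\<^sup>2 \<le> bump h c z" unfolding bump_def by (intro power_mono) auto
  then show ?thesis by (simp add: power2_eq_square)
qed

text \<open>Squaring removes the corner of the positive part: at 0 the quotient is at most
  \<open>\<bar>h\<bar>\<close>.\<close>

lemma max_zero_square_derivative: "((\<lambda>s. (max 0 s)\<^sup>2) has_real_derivative 2 * max 0 s) (at s)"
proof (cases s "0 :: real" rule: linorder_cases)
  case less
  have "((\<lambda>s. (max 0 s)\<^sup>2) has_real_derivative 0) (at s)"
    by (rule has_field_derivative_transform_within_open[OF DERIV_const[of 0], where S = "{..<0}"]) (use less in auto)
  then show ?thesis using less by simp
next
  case greater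
  have "((\<lambda>s. s\<^sup>2) has_real_derivative 2 * s) (at s)" by (auto intro!: derivative_eq_intros)
  then have "((\<lambda>s. (max 0 s)\<^sup>2) has_real_derivative 2 * s) (at s)"
    by (rule has_field_derivative_transform_within_open[where S = "{0<..}"]) (use greater in auto)
  then show ?thesis using greater by simp
next
  case equal
  have "((\<lambda>h. (max 0 h)\<^sup>2 / h) \<longlongrightarrow> 0) (at (0::real))"
  proof (rule Lim_null_comparison)
    show "\<forall>\<^sub>F h in at 0. norm ((max 0 h)\<^sup>2 / h) \<le> \<bar>h :: real\<bar>"
      by (rule always_eventually) (auto simp: max_def power2_eq_square)
    show "((\<lambda>h. \<bar>h :: real\<bar>) \<longlongrightarrow> 0) (at 0)" by (rule tendsto_rabs_zero) (rule tendsto_ident_at)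
  qed
  then show ?thesis using equal by (simp add: DERIV_def)
qed

lemma bump_has_derivative:
  "(bump h c has_derivative (\<lambda>v. bump_gradient h c z \<bullet> v)) (at z)"
proof -
  let ?q = "\<lambda>z. 1 - 4 / h\<^sup>2 * ((z - c) \<bullet> (z - c))"
  have n: "((\<lambda>z. (z - c) \<bullet> (z - c)) has_derivative (\<lambda>v. 2 * ((z - c) \<bullet> v))) (at z)"
    by (auto intro!: derivative_eq_intros simp: inner_commute algebra_simps)
  have q: "(?q has_derivative (\<lambda>v. - (8 / h\<^sup>2) * ((z - c) \<bullet> v))) (at z)"
    using has_derivative_diff[OF has_derivative_const[of 1] has_derivative_mult_right[OF n, of "4 / h\<^sup>2"]] by simp
  have "((\<lambda>s. (max 0 s)\<^sup>2) has_derivative (\<lambda>x. 2 * max 0 (?q z) * x)) (at (?q z))"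
    using max_zero_square_derivative[of "?q z"] by (simp add: has_field_derivative_def)
  from has_derivative_compose[OF q this]
  have "(bump h c has_derivative (\<lambda>v. 2 * max 0 (?q z) * (- (8 / h\<^sup>2) * ((z - c) \<bullet> v)))) (at z)"
    by (simp add: bump_def[abs_def])
  moreover have "(\<lambda>v. 2 * max 0 (?q z) * (- (8 / h\<^sup>2) * ((z - c) \<bullet> v))) = (\<lambda>v. bump_gradient h c z \<bullet> v)"
    by (simp add: bump_gradient_def mult.assoc)
  ultimately show ?thesis by simp
qed

text \<open>Centers of parallel faces differ by \<open>h\<close> times an integer vector, while a
  common point of the supports keeps every coordinate difference below \<open>h\<close>. Faces of
  different directions can have overlapping bumps, hence the fixed \<open>i\<close>.\<close>

lemma face_centers_separated:
  assumes h: "h > 0" and "bump h (face_center h i k) z \<noteq> 0" "bump h (face_center h i l) z \<noteq> 0"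
  shows "k = l"
proof -
  have "k $ j = l $ j" for j
  proof -
    have "\<bar>face_center h i k $ j - face_center h i l $ j\<bar> < h"
      using bump_neq_zeroD[OF h assms(2), of j] bump_neq_zeroD[OF h assms(3), of j] by linarith
    moreover have "face_center h i k $ j - face_center h i l $ j = h * of_int (k $ j - l $ j)"
      by (simp add: face_center_def algebra_simps)
    ultimately have "\<bar>real_of_int (k $ j - l $ j)\<bar> < 1" using h by (simp add: abs_mult)
    then show ?thesis by linarith
  qed
  then show ?thesis by (simp add: vec_eq_iff)
qed

text \<open>At each point at most one bump is nonzero, so the field has norm at most 1 for all
  admissible coefficients \<open>s\<close>.\<close>

lemma bump_sum_test_field:
  fixes K :: "(int^'n) set" and s :: "int^'n \<Rightarrow> real"
  assumes h: "h > 0" and K: "finite K" "\<And>k. k \<in> K \<Longrightarrow> cball (face_center h i k) (h / 2) \<subseteq> A"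
    and s: "\<And>k. \<bar>s k\<bar> \<le> 1"
  shows "test_field A (\<lambda>z. (\<Sum>k\<in>K. s k * bump h (face_center h i k) z) *\<^sub>R axis i 1)"
    (is "test_field A ?\<phi>")
  unfolding test_field_def
proof (intro conjI allI)
  let ?c = "face_center h i"
  have deriv: "(?\<phi> has_derivative (\<lambda>v. (\<Sum>k\<in>K. s k * (bump_gradient h (?c k) x \<bullet> v)) *\<^sub>R axis i 1)) (at x)" for x
    by (auto intro!: derivative_eq_intros bump_has_derivative)
  then show "?\<phi> differentiable (at x)" for x by (auto simp: differentiable_def)
  have "jacobian ?\<phi> (at x) = (\<chi> a b. (\<Sum>k\<in>K. s k * bump_gradient h (?c k) x $ b) * (axis i 1 $ a))" for x
    unfolding jacobian_def frechet_derivative_at[OF deriv, symmetric] matrix_def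
    by (simp add: inner_axis)
  moreover have "continuous_on UNIV (\<lambda>x. bump_gradient h c x)" for c :: "real^'n"
    unfolding bump_gradient_def by (intro continuous_intros)
  ultimately show "continuous_on UNIV (\<lambda>x. jacobian ?\<phi> (at x))"
    by (simp only:) (intro continuous_intros)
  let ?B = "\<Union>k\<in>K. cball (?c k) (h / 2)"
  have "x \<in> ?B" if "?\<phi> x \<noteq> 0" for x
  proof -
    have "(\<Sum>k\<in>K. s k * bump h (?c k) x) \<noteq> 0" using that by auto
    then obtain k where "k \<in> K" "s k * bump h (?c k) x \<noteq> 0" by (rule sum.not_neutral_contains_not_neutral)
    then show ?thesis using bump_eq_zero[OF h, of x "?c k"] by auto
  qed
  moreover have "compact ?B" by (intro compact_UN K) auto
  ultimately have sub: "closure {x. ?\<phi> x \<noteq> 0} \<subseteq> ?B"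
    by (intro closure_minimal compact_imp_closed) auto
  then show "closure {x. ?\<phi> x \<noteq> 0} \<subseteq> A" using K(2) by blast
  show "compact (closure {x. ?\<phi> x \<noteq> 0})"
    unfolding compact_closure
    by (rule bounded_subset[OF compact_imp_bounded[OF \<open>compact ?B\<close>] order.trans[OF closure_subset sub]])
  fix x
  have "\<bar>\<Sum>k\<in>K. s k * bump h (?c k) x\<bar> \<le> 1"
  proof (cases "\<exists>k\<in>K. bump h (?c k) x \<noteq> 0")
    case True
    then obtain k where k: "k \<in> K" "bump h (?c k) x \<noteq> 0" by blast
    have "(\<Sum>l\<in>K. s l * bump h (?c l) x) = (\<Sum>l\<in>{k}. s l * bump h (?c l) x)"
    proof (rule sum.mono_neutral_right)
      show "\<forall>l\<in>K - {k}. s l * bump h (?c l) x = 0"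
        using face_centers_separated[OF h _ k(2)] by (metis DiffD2 insertI1 mult_zero_right)
    qed (use K(1) k(1) in auto)
    then show ?thesis
      using s[of k] bump_nonneg[of h "?c k" x] bump_le_one[of h "?c k" x] by (simp add: abs_mult mult_le_one)
  qed auto
  then show "norm (?\<phi> x) \<le> 1" by (simp add: norm_axis_1)
qed

text \<open>The field has one bump at each face in \<open>K\<close>, with the sign that makes the
  face contribute the absolute value of the jump. The bump is at least 1/2 on a box of thickness
  \<open>t / 2\<close> and side \<open>h / (2 * CARD('n))\<close> just below the center; with the
  factor \<open>1 / t\<close> this gives \<open>1 / 4\<close>.\<close>

lemma total_variation_ge:
  fixes A :: "(real^'n) set" and i :: 'n
  assumes h: "h > 0" and v: "v \<in> V h"
    and K: "finite K" "\<And>k. k \<in> K \<Longrightarrow> cball (face_center h i k) (h / 2) \<subseteq> A"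
  shows "ennreal (1 / 4 * (h / (2 * CARD('n))) ^ (CARD('n) - 1) * (\<Sum>k\<in>K. \<bar>node_diff h v i k\<bar>))
    \<le> total_variation v A"
proof -
  let ?c = "face_center h i" and ?N = "real CARD('n)"
  let ?r = "(h / (2 * ?N)) ^ (CARD('n) - 1)"
  define s where "s k = - sgn (node_diff h v i k)" for k
  define g where "g z = (\<Sum>k\<in>K. s k * bump h (?c k) z)" for z
  define \<phi> :: "real^'n \<Rightarrow> real^'n" where "\<phi> z = g z *\<^sub>R axis i 1" for z
  have \<phi>: "test_field A \<phi>"
    unfolding \<phi>_def g_def by (rule bump_sum_test_field[OF h K]) (auto simp: s_def sgn_if)
  have N: "?N \<ge> 1" by (simp add: Suc_leI)
  have wm [measurable]: "v \<in> borel_measurable borel" and wb: "locally_bounded v"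
    by (rule V_measurable[OF h v], rule V_locally_bounded[OF h v])
  let ?I = "\<lambda>t j. \<integral>z. (v z - v (z + t *\<^sub>R axis j 1)) * \<phi> z $ j / t \<partial>lborel"
  have bound: "1 / 4 * ?r * (\<Sum>k\<in>K. \<bar>node_diff h v i k\<bar>) \<le> (\<Sum>j\<in>UNIV. ?I t j)"
    if t: "0 < t" "t < h / (4 * ?N)" for t
  proof -
    have small: "h / (4 * ?N) \<le> h / 4" using N h by (intro divide_left_mono) auto
    then have th: "t < h / 4" "t \<le> h" using t h by linarith+
    \<comment> \<open>The closed box stops \<open>t / 2\<close> short of the face so as to stay
      inside the half-open cell; the side \<open>h / (2 * ?N)\<close> comes from
      \<open>bump_ge_half\<close>.\<close>
    define lo :: "int^'n \<Rightarrow> real^'n" where "lo k = (\<chi> j. if j = i then ?c k $ j - t else ?c k $ j - h / (4 * ?N))" for k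
    define hi :: "int^'n \<Rightarrow> real^'n" where "hi k = (\<chi> j. if j = i then ?c k $ j - t / 2 else ?c k $ j + h / (4 * ?N))" for k
    have m: "measure lborel (cbox (lo k) (hi k)) = t / 2 * ?r" for k
      by (rule content_slab) (use h t N in \<open>auto simp: lo_def hi_def field_simps\<close>)
    have i1: "integrable lborel (\<lambda>z. c * indicator (cbox (lo k) (hi k)) z)" for c :: real and k
      by (rule integrable_mult_right, rule integrable_real_indicator, simp, rule emeasure_lborel_cbox_finite)
    have box: "index_of h z = k \<and> z $ i \<ge> h * (k $ i + 1) - t \<and> 1 / 2 \<le> bump h (?c k) z"
      if z: "z \<in> cbox (lo k) (hi k)" for z k
    proof (intro conjI)
      have z': "lo k $ j \<le> z $ j" "z $ j \<le> hi k $ j" for j using z by (auto simp: mem_box_cart)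
      show "index_of h z = k"
        unfolding index_of_eq_iff[OF h]
      proof
        fix j show "h * k $ j \<le> z $ j \<and> z $ j < h * k $ j + h"
          using z'[of j] th t small h by (cases "j = i") (auto simp: lo_def hi_def face_center_def algebra_simps)
      qed
      show "z $ i \<ge> h * (k $ i + 1) - t"
        using z'[of i] by (simp add: lo_def face_center_def algebra_simps)
      show "1 / 2 \<le> bump h (?c k) z"
      proof (rule bump_ge_half[OF h])
        fix j show "\<bar>z $ j - ?c k $ j\<bar> \<le> h / (4 * CARD('n))"
          using z'[of j] t by (cases "j = i") (auto simp: lo_def hi_def abs_le_iff)
      qed
    qed
    \<comment> \<open>For \<open>t < h / 2\<close> the slab of the cell \<open>l\<close> meets the support of no bump other than its own, and
       \<open>s\<close> is chosen to make the product nonnegative there.\<close>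
    have termwise: "\<bar>node_diff h v i k\<bar> / 2 * indicator (cbox (lo k) (hi k)) z \<le>
        (v z - v (z + t *\<^sub>R axis i 1)) * (s k * bump h (?c k) z)" for k z
    proof (cases "bump h (?c k) z = 0")
      case True
      then have "z \<notin> cbox (lo k) (hi k)" using box[of z k] by auto
      then show ?thesis using True by simp
    next
      case False
      define l where "l = index_of h z"
      have l: "h * l $ j \<le> z $ j" "z $ j < h * l $ j + h" for j
        using index_of_eq_iff[OF h, of z l] l_def by auto
      show ?thesis
      proof (cases "z $ i \<ge> h * (l $ i + 1) - t")
        case True
        have "k $ j = l $ j" for j
        proof -
          have b: "\<bar>z $ j - ?c k $ j\<bar> < h / 2" by (rule bump_neq_zeroD[OF h False])
          have "h * of_int (k $ j) < h * of_int (l $ j) + h \<and> h * of_int (l $ j) < h * of_int (k $ j) + h"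
          proof (cases "j = i")
            case True
            then have "?c k $ j = h * k $ j + h" by (simp add: face_center_def distrib_left)
            moreover have "z $ j \<ge> h * l $ j + h - t"
              using \<open>z $ i \<ge> h * (l $ i + 1) - t\<close> \<open>j = i\<close> by (simp add: distrib_left)
            ultimately show ?thesis using b l(2)[of j] th unfolding abs_less_iff by linarith
          next
            case False
            then have "?c k $ j = h * k $ j + h / 2" by (simp add: face_center_def distrib_left)
            then show ?thesis using b l[of j] unfolding abs_less_iff by linarith
          qed
          then have "h * of_int (k $ j) < h * (of_int (l $ j) + 1)" "h * of_int (l $ j) < h * (of_int (k $ j) + 1)"
            by (simp_all only: distrib_left mult_1_right)
          then have "real_of_int (k $ j) < of_int (l $ j) + 1" "real_of_int (l $ j) < of_int (k $ j) + 1"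
            using h by simp_all
          then show ?thesis by linarith
        qed
        then have kl: "k = l" by (simp add: vec_eq_iff)
        have "(v z - v (z + t *\<^sub>R axis i 1)) * (s k * bump h (?c k) z) = \<bar>node_diff h v i k\<bar> * bump h (?c k) z"
          unfolding V_shift[OF h v t(1) th(2)] l_def[symmetric] kl[symmetric] using True
          by (simp add: kl s_def abs_sgn)
        moreover have "1 / 2 * indicator (cbox (lo k) (hi k)) z \<le> bump h (?c k) z"
          using box[of z k] bump_nonneg[of h "?c k" z] by (auto simp: indicator_def)
        then have "\<bar>node_diff h v i k\<bar> * (1 / 2 * indicator (cbox (lo k) (hi k)) z) \<le>
            \<bar>node_diff h v i k\<bar> * bump h (?c k) z"
          by (intro mult_left_mono) auto
        ultimately show ?thesis by (simp only: times_divide_eq_left times_divide_eq_right mult_1 divide_inverse mult.assoc)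
      next
        case False
        then have "z \<notin> cbox (lo k) (hi k)" using box[of z k] l_def by auto
        then show ?thesis
          unfolding V_shift[OF h v t(1) th(2)] l_def[symmetric] using False by simp
      qed
    qed
    \<comment> \<open>Integrability has to be proved here: the default integral 0 is no upper bound
      for a positive sum. \<open>B\<close> confines the support of \<open>g\<close>.\<close>
    define B where "B = (\<Union>k\<in>K. cball (?c k) (h / 2))"
    have "bounded B" unfolding B_def using K(1) by (intro bounded_UN) auto
    then obtain R where R: "\<forall>x\<in>B. norm x \<le> R" unfolding bounded_iff ..
    have gz: "g z = 0" if "norm z > R" for z
    proof -
      have "z \<notin> B" using R that by (meson not_le)
      then have "z \<notin> cball (?c k) (h / 2)" if "k \<in> K" for k using that unfolding B_def by blast
      then show ?thesis unfolding g_def by (intro sum.neutral) (simp add: bump_eq_zero[OF h])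
    qed
    have gc: "continuous_on UNIV g"
      unfolding g_def bump_def by (intro continuous_intros)
    have "integrable lborel (\<lambda>z. v z * g z)"
      by (rule integrable_locally_bounded_mult[OF wm wb gc gz])
    moreover have "integrable lborel (\<lambda>z. v (z + t *\<^sub>R axis i 1) * g z)"
      by (intro integrable_locally_bounded_mult[OF _ locally_bounded_shift[OF wb] gc gz]) measurable
    ultimately have "integrable lborel (\<lambda>z. v z * g z - v (z + t *\<^sub>R axis i 1) * g z)"
      by (rule Bochner_Integration.integrable_diff)
    then have ig: "integrable lborel (\<lambda>z. (v z - v (z + t *\<^sub>R axis i 1)) * g z / t)"
      by (intro integrable_divide) (simp add: left_diff_distrib)
    have "(\<Sum>k\<in>K. \<bar>node_diff h v i k\<bar> / 2 / t * measure lborel (cbox (lo k) (hi k))) =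
        (\<integral>z. (\<Sum>k\<in>K. \<bar>node_diff h v i k\<bar> / 2 / t * indicator (cbox (lo k) (hi k)) z) \<partial>lborel)"
      by (subst Bochner_Integration.integral_sum[OF i1]) simp
    also have "\<dots> \<le> (\<integral>z. (v z - v (z + t *\<^sub>R axis i 1)) * g z / t \<partial>lborel)"
    proof (rule integral_mono[OF _ ig])
      show "integrable lborel (\<lambda>z. \<Sum>k\<in>K. \<bar>node_diff h v i k\<bar> / 2 / t * indicator (cbox (lo k) (hi k)) z)"
        by (intro Bochner_Integration.integrable_sum i1)
      fix z
      have "(\<Sum>k\<in>K. \<bar>node_diff h v i k\<bar> / 2 * indicator (cbox (lo k) (hi k)) z) \<le>
          (\<Sum>k\<in>K. (v z - v (z + t *\<^sub>R axis i 1)) * (s k * bump h (?c k) z))"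
        by (intro sum_mono termwise)
      then have "(\<Sum>k\<in>K. \<bar>node_diff h v i k\<bar> / 2 * indicator (cbox (lo k) (hi k)) z) / t \<le>
          (v z - v (z + t *\<^sub>R axis i 1)) * g z / t"
        unfolding g_def sum_distrib_left using t by (intro divide_right_mono) auto
      then show "(\<Sum>k\<in>K. \<bar>node_diff h v i k\<bar> / 2 / t * indicator (cbox (lo k) (hi k)) z) \<le>
          (v z - v (z + t *\<^sub>R axis i 1)) * g z / t"
        by (simp add: sum_divide_distrib)
    qed
    also have "\<dots> = ?I t i" by (simp add: \<phi>_def)
    also have "\<dots> = (\<Sum>j\<in>{i}. ?I t j)" by simp
    also have "\<dots> = (\<Sum>j\<in>UNIV. ?I t j)"
      by (rule sum.mono_neutral_left) (auto simp: \<phi>_def axis_def)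
    finally have "(\<Sum>k\<in>K. \<bar>node_diff h v i k\<bar> / 2 / t * (t / 2 * ?r)) \<le> (\<Sum>j\<in>UNIV. ?I t j)"
      by (simp only: m)
    moreover have "\<bar>node_diff h v i k\<bar> / 2 / t * (t / 2 * ?r) = 1 / 4 * ?r * \<bar>node_diff h v i k\<bar>" for k
      using t by simp
    ultimately show ?thesis by (simp only: sum_distrib_left)
  qed
  have "eventually (\<lambda>n. inverse (real (Suc n)) < h / (4 * ?N)) sequentially"
    using h N by (intro order_tendstoD(2)[OF LIMSEQ_inverse_real_of_nat]) auto
  then have "eventually (\<lambda>n. 1 / 4 * ?r * (\<Sum>k\<in>K. \<bar>node_diff h v i k\<bar>) \<le>
      (\<Sum>j\<in>UNIV. ?I (inverse (real (Suc n))) j)) sequentially"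
    by (rule eventually_mono) (intro bound; simp)
  then have "1 / 4 * ?r * (\<Sum>k\<in>K. \<bar>node_diff h v i k\<bar>) \<le> (LINT x:A|lebesgue. v x * divergence \<phi> x)"
    by (intro tendsto_lowerbound[OF weak_divergence_limit[OF \<phi> wm wb]]) auto
  then have "ennreal (1 / 4 * ?r * (\<Sum>k\<in>K. \<bar>node_diff h v i k\<bar>)) \<le>
      ennreal (LINT x:A|lebesgue. v x * divergence \<phi> x)"
    by (rule ennreal_leI)
  also have "\<dots> \<le> total_variation v A"
    unfolding total_variation_def using \<phi> by (intro SUP_upper) auto
  finally show ?thesis by simp
qed

section \<open>Comparison with the total variation\<close>

definition edge_sum :: "(int^'n) set \<Rightarrow> (int^'n \<Rightarrow> real) \<Rightarrow> int^'n \<Rightarrow> real" where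
  "edge_sum M a k = (\<Sum>m\<in>M. \<Sum>i\<in>UNIV. \<bar>a (k + m + axis i 1) - a (k + m)\<bar>)"

lemma edge_sum_nonneg: "0 \<le> edge_sum M a k"
  unfolding edge_sum_def by (intro sum_nonneg) auto

lemma edge_sum_mono:
  assumes "finite M'" "M \<subseteq> M'"
  shows "edge_sum M a k \<le> edge_sum M' a k"
  unfolding edge_sum_def by (intro sum_mono2 assms) (auto intro: sum_nonneg)

lemma edge_le_edge_sum:
  assumes "finite M" "m \<in> M"
  shows "\<bar>a (k + m + axis i 1) - a (k + m)\<bar> \<le> edge_sum M a k"
proof -
  have "\<bar>a (k + m + axis i 1) - a (k + m)\<bar> \<le> (\<Sum>i\<in>UNIV. \<bar>a (k + m + axis i 1) - a (k + m)\<bar>)"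
    by (rule member_le_sum[where f = "\<lambda>i. \<bar>a (k + m + axis i 1) - a (k + m)\<bar>"]) auto
  also have "\<dots> \<le> edge_sum M a k"
    unfolding edge_sum_def
    by (rule member_le_sum[where f = "\<lambda>m. \<Sum>i\<in>UNIV. \<bar>a (k + m + axis i 1) - a (k + m)\<bar>"])
      (use assms in \<open>auto intro: sum_nonneg\<close>)
  finally show ?thesis .
qed

text \<open>\<open>M\<close> and \<open>R\<close> must not depend on \<open>a\<close> or \<open>k\<close>: they enter the constant of the upper bound.\<close>

definition edge_connected :: "int^'n \<Rightarrow> bool" where
  "edge_connected y \<longleftrightarrow> (\<exists>M R. finite M \<and> 0 \<le> R \<and>
    (\<forall>a k. \<bar>a (k + y) - a k\<bar> \<le> R * edge_sum M a k))"

text \<open>One more edge of a lattice path, traversed in either direction. As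
  \<open>edge_sum\<close> counts all directions at each base point, only the base point
  \<open>m\<close> has to be added.\<close>

lemma edge_connected_step:
  fixes y y' m :: "int^'n"
  assumes y: "edge_connected y" and edge: "(y = m \<and> y' = m + axis i 1) \<or> (y' = m \<and> y = m + axis i 1)"
  shows "edge_connected y'"
proof -
  obtain M R where M: "finite M" "0 \<le> R"
    and MR: "\<And>(a :: int^'n \<Rightarrow> real) k. \<bar>a (k + y) - a k\<bar> \<le> R * edge_sum M a k"
    using y unfolding edge_connected_def by blast
  have "\<bar>a (k + y') - a k\<bar> \<le> (R + 1) * edge_sum (insert m M) a k" for a :: "int^'n \<Rightarrow> real" and k
  proof -
    have "\<bar>a (k + y') - a (k + y)\<bar> = \<bar>a (k + m + axis i 1) - a (k + m)\<bar>"
      using edge by (auto simp: add.assoc)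
    also have "\<dots> \<le> edge_sum (insert m M) a k" by (rule edge_le_edge_sum) (use M in auto)
    finally have 1: "\<bar>a (k + y') - a (k + y)\<bar> \<le> edge_sum (insert m M) a k" .
    have "R * edge_sum M a k \<le> R * edge_sum (insert m M) a k"
      by (intro mult_left_mono edge_sum_mono M) (use M in auto)
    then have "\<bar>a (k + y) - a k\<bar> \<le> R * edge_sum (insert m M) a k" using MR[of a k] by linarith
    then show ?thesis using 1 by (simp add: distrib_right)
  qed
  then show ?thesis
    unfolding edge_connected_def using M by (intro exI[of _ "insert m M"] exI[of _ "R + 1"]) auto
qed

lemma axis_plus: "axis i (a + b) = axis i a + (axis i b :: 'a::monoid_add ^ 'n)"
  by (auto simp: axis_def vec_eq_iff)

lemma edge_connected_axis:
  fixes y :: "int^'n"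
  assumes "edge_connected y"
  shows "edge_connected (y + axis i c)"
proof (induction c rule: int_induct[where k = 0])
  case base
  have "axis i 0 = (0 :: int^'n)" by (simp add: axis_def vec_eq_iff)
  then show ?case using assms by (simp only: add_0_right)
next
  case (step1 c)
  show ?case
    by (rule edge_connected_step[OF step1(2), of "y + axis i c" _ i]) (simp add: axis_plus add.assoc)
next
  case (step2 c)
  have "axis i c = axis i (c - 1) + axis i 1" using axis_plus[of i "c - 1" 1] by simp
  then show ?case
    by (intro edge_connected_step[OF step2(2), of "y + axis i (c - 1)" _ i]) (simp add: add.assoc)
qed

text \<open>The path runs along the coordinate axes one after another; \<open>T\<close> holds the
  coordinates already adjusted.\<close>

lemma all_edge_connected: "edge_connected (y :: int^'n)"
proof -
  have "edge_connected (\<chi> j. if j \<in> T then y $ j else 0)" for T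
  proof (induction T rule: finite_induct[OF finite])
    case 1
    have "(\<chi> j. if j \<in> {} then y $ j else 0) = 0" by (simp add: vec_eq_iff)
    moreover have "edge_connected (0 :: int^'n)"
      unfolding edge_connected_def by (intro exI[of _ "{}"] exI[of _ 0]) auto
    ultimately show ?case by (simp only:)
  next
    case (2 i T)
    have "(\<chi> j. if j \<in> insert i T then y $ j else 0) = (\<chi> j. if j \<in> T then y $ j else 0) + axis i (y $ i)"
      using 2(2) by (auto simp: vec_eq_iff axis_def)
    then show ?case using edge_connected_axis[OF 2(3)] by (simp only:)
  qed
  from this[of UNIV] show ?thesis by simp
qed

text \<open>Finiteness of \<open>S\<close> allows one stencil and one factor for all
  \<open>y\<close>: the union and the sum.\<close>

lemma edge_path_bound:
  fixes S :: "(int^'n) set"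
  assumes "finite S"
  obtains M R where "finite M" "0 \<le> R"
    "\<And>(a :: int^'n \<Rightarrow> real) k y. y \<in> S \<Longrightarrow> \<bar>a (k + y) - a k\<bar> \<le> R * edge_sum M a k"
proof -
  have "\<exists>M R. finite M \<and> 0 \<le> R \<and> (\<forall>(a :: int^'n \<Rightarrow> real) k. \<bar>a (k + y) - a k\<bar> \<le> R * edge_sum M a k)" for y
    using all_edge_connected[of y] unfolding edge_connected_def .
  then obtain M R where MR: "\<And>y. finite (M y)" "\<And>y. (0::real) \<le> R y"
    "\<And>y (a :: int^'n \<Rightarrow> real) k. \<bar>a (k + y) - a k\<bar> \<le> R y * edge_sum (M y) a k"
    by metis
  have "\<bar>a (k + y) - a k\<bar> \<le> sum R S * edge_sum (\<Union>y\<in>S. M y) a k" if "y \<in> S" for a :: "int^'n \<Rightarrow> real" and k y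
  proof -
    note MR(3)[of a k y]
    also have "R y * edge_sum (M y) a k \<le> sum R S * edge_sum (\<Union>y\<in>S. M y) a k"
      using assms MR that
      by (intro mult_mono edge_sum_mono edge_sum_nonneg member_le_sum sum_nonneg) auto
    finally show ?thesis .
  qed
  moreover have "finite (\<Union>y\<in>S. M y)" "0 \<le> sum R S" using assms MR(1,2) by (auto intro: sum_nonneg)
  ultimately show ?thesis using that by blast
qed

text \<open>The margin \<open>e\<close> is the origin of both thresholds \<open>h\<^sub>0\<close>:
  all points that an estimate touches lie within a fixed multiple of \<open>h\<close> of the smaller
  set.\<close>

lemma compactly_inside_margin:
  fixes A B :: "'a::euclidean_space set"
  assumes "A \<subset>\<subset> B" "open B"
  obtains e where "e > 0" "\<And>x y. x \<in> A \<Longrightarrow> dist x y < e \<Longrightarrow> y \<in> B"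
proof -
  obtain e where e: "e > 0" "(\<Union>x\<in>closure A. ball x e) \<subseteq> B"
    using compact_subset_open_imp_ball_epsilon_subset[of "closure A" B] assms
    unfolding compactly_inside_def by blast
  have "y \<in> B" if "x \<in> A" "dist x y < e" for x y
  proof -
    have "x \<in> closure A" using closure_subset that(1) by blast
    then have "y \<in> (\<Union>x\<in>closure A. ball x e)" using that(2) by auto
    then show ?thesis using e(2) by blast
  qed
  then show ?thesis using e(1) that by blast
qed

section \<open>The two bounds in terms of sums over integer indices\<close>

lemma total_variation_cong:
  assumes "\<And>x. x \<in> A \<Longrightarrow> u x = v x"
  shows "total_variation u A = total_variation v A"
proof -
  have "(\<lambda>x. indicator A x *\<^sub>R (u x * divergence \<phi> x)) = (\<lambda>x. indicator A x *\<^sub>R (v x * divergence \<phi> x))" for \<phi>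
    using assms by (auto simp: indicator_def)
  then show ?thesis unfolding total_variation_def set_lebesgue_integral_def by simp
qed

lemma inj_node: "h > 0 \<Longrightarrow> inj (node h)"
  by (rule inj_on_inverseI[where g = "index_of h"]) simp

lemma discrete_sum_nodes:
  fixes S :: "(int^'n) set"
  assumes h: "h > 0"
  shows "discrete_sum S F h v A = h ^ (CARD('n) - 1) *
    (\<Sum>k | node h k \<in> inner_nodes S h A. extension S F (\<lambda>y\<in>S. v (node h (k + y))))"
proof -
  have "inner_nodes S h A \<inter> lattice h = node h ` {k. node h k \<in> inner_nodes S h A}"
    by (auto simp: lattice_eq)
  moreover have "patch S h v (node h k) = (\<lambda>y\<in>S. v (node h (k + y)))" for k
    unfolding patch_def by (simp add: node_add)
  ultimately show ?thesis
    unfolding discrete_sum_def by (simp add: sum.reindex[OF inj_on_subset[OF inj_node[OF h]]])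
qed

lemma finite_inner_node_indices:
  assumes "h > 0" "bounded A" "0 \<in> S"
  shows "finite {k. node h k \<in> inner_nodes S h A}"
  by (rule finite_subset[OF _ finite_node_in_bounded[OF assms(1,2)]])
    (use assms(3) in \<open>force simp: inner_nodes_def\<close>)

lemma dist_node_index:
  fixes z :: "real^'n"
  assumes "h > 0"
  shows "norm (node h (index_of h z) - z) \<le> h * CARD('n)"
proof -
  have "norm (node h (index_of h z) - z) \<le> (\<Sum>i\<in>UNIV. \<bar>(node h (index_of h z) - z) $ i\<bar>)"
    by (rule norm_le_l1_cart)
  also have "\<dots> \<le> (\<Sum>i\<in>(UNIV :: 'n set). h)"
  proof (rule sum_mono)
    fix i
    show "\<bar>(node h (index_of h z) - z) $ i\<bar> \<le> h"
      using index_of_eq_iff[OF assms, of z "index_of h z"] by (simp add: abs_le_iff) (smt (verit))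
  qed
  finally show ?thesis by (simp add: mult.commute)
qed

text \<open>Coercivity bounds the energy at a node below by \<open>c\<close> times the jumps along
  the edges issuing upward from it. Small \<open>h\<close> makes the node of every cell that meets
  \<open>A\<close> an inner node of \<open>B\<close>, so \<open>total_variation_le\<close> applies
  with these nodes.\<close>

lemma coercive_total_variation_bound:
  fixes S :: "(int^'n) set" and A B :: "(real^'n) set"
  assumes S: "finite S" "0 \<in> S" "\<And>i. axis i 1 \<in> S"
    and c: "c > 0" "\<And>u. u \<in> S \<rightarrow>\<^sub>E UNIV \<Longrightarrow> c * (\<Sum>i\<in>UNIV. \<bar>u (axis i 1) - u 0\<bar>) \<le> extension S F u"
    and AB: "A \<subset>\<subset> B" "open B" "bounded B"
  shows "\<exists>h\<^sub>0>0. \<forall>h. 0 < h \<and> h < h\<^sub>0 \<longrightarrow>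
    (\<forall>v\<in>V h. ennreal c * total_variation v A \<le> ennreal (discrete_sum S F h v B))"
proof -
  obtain e where e: "e > 0" "\<And>x y. x \<in> A \<Longrightarrow> dist x y < e \<Longrightarrow> y \<in> B"
    using compactly_inside_margin[OF AB(1,2)] by blast
  \<comment> \<open>\<open>CARD('n)\<close> bounds the distance from a point to the node of its cell
    in units of \<open>h\<close>; the sum bounds each vector of the stencil
    \<open>S\<close>.\<close>
  define r where "r = CARD('n) + (\<Sum>y\<in>S. norm (vec_of_int y))"
  have r: "r > 0" unfolding r_def by (intro add_pos_nonneg sum_nonneg) auto
  show ?thesis
  proof (intro exI[of _ "e / r"] conjI allI impI ballI)
    show "e / r > 0" using e(1) r by simp
    fix h :: real and v :: "real^'n \<Rightarrow> real" assume h': "0 < h \<and> h < e / r" and v: "v \<in> V h"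
    then have h: "h > 0" and hr: "h * r < e" using r by (auto simp: pos_less_divide_eq)
    let ?K = "{k. node h k \<in> inner_nodes S h B}"
    have fin: "finite ?K" by (rule finite_inner_node_indices[OF h AB(3) S(2)])
    have "index_of h ` A \<subseteq> ?K"
    proof clarify
      fix z assume z: "z \<in> A"
      let ?x = "node h (index_of h z)"
      have "?x + h *\<^sub>R vec_of_int y \<in> B" if y: "y \<in> S" for y
      proof (rule e(2)[OF z])
        have "dist z (?x + h *\<^sub>R vec_of_int y) = norm ((?x - z) + h *\<^sub>R vec_of_int y)"
          by (simp add: dist_norm norm_minus_commute algebra_simps)
        also have "\<dots> \<le> norm (?x - z) + norm (h *\<^sub>R vec_of_int y)" by (rule norm_triangle_ineq)
        also have "\<dots> \<le> h * CARD('n) + h * (\<Sum>y\<in>S. norm (vec_of_int y))"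
          using h S(1) y
          by (intro add_mono dist_node_index) (auto intro!: member_le_sum[where f = "\<lambda>y. norm (vec_of_int y)"])
        also have "\<dots> < e" using hr by (simp add: r_def distrib_left)
        finally show "dist z (?x + h *\<^sub>R vec_of_int y) < e" .
      qed
      then show "?x \<in> inner_nodes S h B" by (simp add: inner_nodes_def)
    qed
    then have "total_variation v A \<le> ennreal (h ^ (CARD('n) - 1) * (\<Sum>k\<in>?K. \<Sum>i\<in>UNIV. \<bar>node_diff h v i k\<bar>))"
      by (rule total_variation_le[OF h v fin])
    then have "ennreal c * total_variation v A \<le>
        ennreal c * ennreal (h ^ (CARD('n) - 1) * (\<Sum>k\<in>?K. \<Sum>i\<in>UNIV. \<bar>node_diff h v i k\<bar>))"
      by (rule mult_left_mono) simp
    also have "\<dots> = ennreal (h ^ (CARD('n) - 1) * (\<Sum>k\<in>?K. c * (\<Sum>i\<in>UNIV. \<bar>node_diff h v i k\<bar>)))"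
      using c h by (subst ennreal_mult[symmetric]) (auto intro!: sum_nonneg mult_nonneg_nonneg simp: sum_distrib_left[symmetric] mult.left_commute)
    also have "\<dots> \<le> ennreal (discrete_sum S F h v B)"
      unfolding discrete_sum_nodes[OF h]
    proof (intro ennreal_leI mult_left_mono sum_mono)
      fix k
      show "c * (\<Sum>i\<in>UNIV. \<bar>node_diff h v i k\<bar>) \<le> extension S F (\<lambda>y\<in>S. v (node h (k + y)))"
        using c(2)[of "\<lambda>y\<in>S. v (node h (k + y))"] S(2,3) by (simp add: node_diff_def)
    qed (use h in auto)
    finally show "ennreal c * total_variation v A \<le> ennreal (discrete_sum S F h v B)" .
  qed
qed

lemma face_center_eq:
  "face_center h i k = node h k + h *\<^sub>R (\<chi> j. 1 / 2 + (if j = i then 1 / 2 else 0))"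
  by (auto simp: face_center_def vec_eq_iff distrib_left)

text \<open>The energy at a node is bounded by the jumps over a stencil of edges around it, and each
  translated family of parallel faces is compared with the total variation separately.
  \<open>C\<close> is fixed before the sets, as the theorem demands.\<close>

lemma (in normalized_cube_function) discrete_sum_total_variation_bound:
  assumes S: "0 \<in> S"
  obtains C where "C > 0"
    "\<And>B \<Omega> :: (real^'n) set. B \<subset>\<subset> \<Omega> \<Longrightarrow> open \<Omega> \<Longrightarrow> bounded B \<Longrightarrow>
      \<exists>h\<^sub>0>0. \<forall>h. 0 < h \<and> h < h\<^sub>0 \<longrightarrow>
        (\<forall>v\<in>V h. ennreal (discrete_sum S F h v B) \<le> ennreal C * total_variation v \<Omega>)"
proof -
  obtain M R where M: "finite M" "0 \<le> R"
    and MR: "\<And>(a :: int^'n \<Rightarrow> real) k y. y \<in> S \<Longrightarrow> \<bar>a (k + y) - a k\<bar> \<le> R * edge_sum M a k"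
    using edge_path_bound[OF finite_S] by blast
  let ?N = "CARD('n)"
  let ?f = "\<lambda>i :: 'n. (\<chi> j. 1 / 2 + (if j = i then 1 / 2 else 0)) :: real^'n"
  \<comment> \<open>\<open>D\<close> collects the constants of \<open>extension_le\<close> and
    \<open>edge_path_bound\<close>. In \<open>C\<close>, the factors \<open>card M\<close> and
    \<open>?N\<close> count the pairs of a base point and a direction, and
    \<open>4 * (2 * ?N) ^ (?N - 1)\<close> inverts the constant of
    \<open>total_variation_ge\<close>. The added 1 makes \<open>C\<close> positive, as the case of
    infinite total variation requires.\<close>
  define D where "D = F_max * (card S * R)"
  define C where "C = D * (card M * ?N * (4 * (2 * ?N) ^ (?N - 1))) + 1"
  have D: "D \<ge> 0" unfolding D_def using F_max_nonneg M by simp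
  then have C: "C > 0" unfolding C_def by (intro add_nonneg_pos) auto
  \<comment> \<open>\<open>r - 1\<close> bounds the distance, in units of \<open>h\<close>, from a
    node to the face centers of its stencil; the remaining 1 leaves room for the bump radius
    \<open>h / 2\<close>.\<close>
  define r where "r = (\<Sum>m\<in>M. \<Sum>i\<in>UNIV. norm (vec_of_int m + ?f i)) + 1"
  have r: "r > 0" unfolding r_def by (intro add_nonneg_pos sum_nonneg) auto
  have "\<exists>h\<^sub>0>0. \<forall>h. 0 < h \<and> h < h\<^sub>0 \<longrightarrow>
        (\<forall>v\<in>V h. ennreal (discrete_sum S F h v B) \<le> ennreal C * total_variation v \<Omega>)"
    if B: "B \<subset>\<subset> \<Omega>" "open \<Omega>" "bounded B" for B \<Omega> :: "(real^'n) set"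
  proof -
    obtain e where e: "e > 0" "\<And>x y. x \<in> B \<Longrightarrow> dist x y < e \<Longrightarrow> y \<in> \<Omega>"
      using compactly_inside_margin[OF B(1,2)] by blast
    show ?thesis
    proof (intro exI[of _ "e / r"] conjI allI impI ballI)
      show "e / r > 0" using e(1) r by simp
      fix h :: real and v :: "real^'n \<Rightarrow> real" assume h': "0 < h \<and> h < e / r" and v: "v \<in> V h"
      then have h: "h > 0" and hr: "h * r < e" using r by (auto simp: pos_less_divide_eq)
      let ?K = "{k. node h k \<in> inner_nodes S h B}"
      let ?c = "h ^ (?N - 1)"
      have fin: "finite ?K" by (rule finite_inner_node_indices[OF h B(3) S])
      have inside: "cball (face_center h i (k + m)) (h / 2) \<subseteq> \<Omega>" if k: "k \<in> ?K" and m: "m \<in> M" for i k m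
      proof
        fix z assume z: "z \<in> cball (face_center h i (k + m)) (h / 2)"
        have kB: "node h k \<in> B" using k S by (force simp: inner_nodes_def)
        have "norm (vec_of_int m + ?f i) \<le> (\<Sum>i\<in>UNIV. norm (vec_of_int m + ?f i))"
          by (rule member_le_sum) auto
        also have "\<dots> \<le> (\<Sum>m\<in>M. \<Sum>i\<in>UNIV. norm (vec_of_int m + ?f i))"
          using M m by (intro member_le_sum[where f = "\<lambda>m. \<Sum>i\<in>UNIV. norm (vec_of_int m + ?f i)"])
            (auto intro: sum_nonneg)
        finally have "norm (vec_of_int m + ?f i) \<le> r - 1" by (simp add: r_def)
        then have "h * norm (vec_of_int m + ?f i) \<le> h * (r - 1)" using h by (intro mult_left_mono) auto
        moreover have "dist (node h k) (face_center h i (k + m)) = h * norm (vec_of_int m + ?f i)"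
        proof -
          have "face_center h i (k + m) = node h k + h *\<^sub>R (vec_of_int m + ?f i)"
            by (simp add: face_center_eq node_add scaleR_add_right add.assoc)
          then show ?thesis using h by (simp add: dist_norm del: scaleR_add_right)
        qed
        ultimately have "dist (node h k) z \<le> h * (r - 1) + h / 2"
          using z dist_triangle[of "node h k" z "face_center h i (k + m)"] by simp
        also have "\<dots> < e" using hr h by (simp add: right_diff_distrib)
        finally show "z \<in> \<Omega>" by (rule e(2)[OF kB])
      qed
      show "ennreal (discrete_sum S F h v B) \<le> ennreal C * total_variation v \<Omega>"
      proof (cases "total_variation v \<Omega>")
        case (real T)
        \<comment> \<open>Shifting by \<open>m\<close> is injective, so for fixed \<open>m\<close>
          and \<open>i\<close> the faces are distinct and one field sees them all.\<close>
        have face: "?c * (\<Sum>k\<in>?K. \<bar>node_diff h v i (k + m)\<bar>) \<le> 4 * (2 * ?N) ^ (?N - 1) * T"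
          if m: "m \<in> M" for i m
        proof -
          have "ennreal (1 / 4 * (h / (2 * ?N)) ^ (?N - 1) * (\<Sum>k\<in>(\<lambda>k. k + m) ` ?K. \<bar>node_diff h v i k\<bar>)) \<le> ennreal T"
            using total_variation_ge[OF h v, of "(\<lambda>k. k + m) ` ?K" i \<Omega>] fin inside[OF _ m] real by auto
          then have "1 / 4 * (h / (2 * ?N)) ^ (?N - 1) * (\<Sum>k\<in>(\<lambda>k. k + m) ` ?K. \<bar>node_diff h v i k\<bar>) \<le> T"
            using real by (simp add: ennreal_le_iff)
          moreover have "(\<Sum>k\<in>(\<lambda>k. k + m) ` ?K. \<bar>node_diff h v i k\<bar>) = (\<Sum>k\<in>?K. \<bar>node_diff h v i (k + m)\<bar>)"
            by (subst sum.reindex) (auto simp: inj_on_def)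
          ultimately show ?thesis by (simp add: power_divide field_simps)
        qed
        have ext: "extension S F (\<lambda>y\<in>S. v (node h (k + y))) \<le>
            D * (\<Sum>m\<in>M. \<Sum>i\<in>UNIV. \<bar>node_diff h v i (k + m)\<bar>)" for k
        proof -
          let ?a = "\<lambda>k. v (node h k)"
          have "extension S F (\<lambda>y\<in>S. ?a (k + y)) \<le> F_max * (\<Sum>y\<in>S. \<bar>?a (k + y) - ?a k\<bar>)"
            using extension_le[OF S, of "\<lambda>y\<in>S. ?a (k + y)"] S by simp
          also have "\<dots> \<le> F_max * (\<Sum>y\<in>S. R * edge_sum M ?a k)"
            by (intro mult_left_mono sum_mono F_max_nonneg MR[of _ ?a])
          also have "\<dots> = D * edge_sum M ?a k" by (simp add: D_def)
          finally show ?thesis by (simp add: edge_sum_def node_diff_def)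
        qed
        have "discrete_sum S F h v B \<le> ?c * (\<Sum>k\<in>?K. D * (\<Sum>m\<in>M. \<Sum>i\<in>UNIV. \<bar>node_diff h v i (k + m)\<bar>))"
          unfolding discrete_sum_nodes[OF h] using h by (intro mult_left_mono sum_mono ext) auto
        also have "\<dots> = D * (?c * (\<Sum>k\<in>?K. \<Sum>m\<in>M. \<Sum>i\<in>UNIV. \<bar>node_diff h v i (k + m)\<bar>))"
          by (simp add: sum_distrib_left[symmetric] mult.left_commute)
        also have "(\<Sum>k\<in>?K. \<Sum>m\<in>M. \<Sum>i\<in>UNIV. \<bar>node_diff h v i (k + m)\<bar>) =
            (\<Sum>m\<in>M. \<Sum>k\<in>?K. \<Sum>i\<in>UNIV. \<bar>node_diff h v i (k + m)\<bar>)"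
          by (rule sum.swap)
        also have "\<dots> = (\<Sum>m\<in>M. \<Sum>i\<in>UNIV. \<Sum>k\<in>?K. \<bar>node_diff h v i (k + m)\<bar>)"
          by (intro sum.cong refl sum.swap)
        also have "D * (?c * (\<Sum>m\<in>M. \<Sum>i\<in>UNIV. \<Sum>k\<in>?K. \<bar>node_diff h v i (k + m)\<bar>)) =
            D * (\<Sum>m\<in>M. \<Sum>i\<in>UNIV. ?c * (\<Sum>k\<in>?K. \<bar>node_diff h v i (k + m)\<bar>))"
          by (simp only: sum_distrib_left)
        also have "\<dots> \<le> D * (\<Sum>m\<in>M. \<Sum>i\<in>(UNIV :: 'n set). 4 * (2 * ?N) ^ (?N - 1) * T)"
          by (intro mult_left_mono sum_mono face D)
        also have "\<dots> \<le> C * T" using real(1) by (simp add: C_def distrib_right)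
        finally have "ennreal (discrete_sum S F h v B) \<le> ennreal (C * T)" by (rule ennreal_leI)
        also have "\<dots> = ennreal C * total_variation v \<Omega>" using real C by (simp add: ennreal_mult)
        finally show ?thesis .
      next
        case top
        then show ?thesis using C by (simp add: ennreal_mult_top)
      qed
    qed
  qed
  then show ?thesis using that[OF C] by blast
qed

theorem proposition4p1:
  fixes S :: "(int^'n) set"
    and F :: "((int^'n) \<Rightarrow> real) \<Rightarrow> real"
    and \<Omega> :: "(real^'n) set"
  assumes "finite S"
    and "\<forall>u\<in>cube S. F u \<ge> 0"
    and "submodular_on_cube S F"
    and "F (\<lambda>y\<in>S. 0) = 0" and "F (\<lambda>y\<in>S. 1) = 0"
    and "coercive S F"
    and "open \<Omega>" and "bounded \<Omega>"
  shows "(\<forall>h>0. convex_L1 \<Omega> (\<lambda>u. J S F h u \<Omega>) \<and> (\<lambda>u. J S F h u \<Omega>) \<in> GC \<Omega>) \<and>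
    (\<exists>C\<^sub>1 C\<^sub>2 :: real. 0 < C\<^sub>1 \<and> C\<^sub>1 < C\<^sub>2 \<and>
      (\<forall>A B. open A \<and> open B \<and> A \<subset>\<subset> B \<and> B \<subset>\<subset> \<Omega> \<longrightarrow>
        (\<exists>h\<^sub>0>0. \<forall>h. 0 < h \<and> h < h\<^sub>0 \<longrightarrow>
          (\<forall>u \<in> V_on h \<Omega>.
             ennreal C\<^sub>1 * total_variation u A \<le> J S F h u B \<and>
             J S F h u B \<le> ennreal C\<^sub>2 * total_variation u \<Omega>))))"
proof -
  interpret normalized_cube_function S F
    using assms by unfold_locales auto
  obtain c where S: "0 \<in> S" "\<And>i. axis i 1 \<in> S" and c: "c > 0"
    "\<And>u. u \<in> S \<rightarrow>\<^sub>E UNIV \<Longrightarrow> c * (\<Sum>i\<in>UNIV. \<bar>u (axis i 1) - u 0\<bar>) \<le> extension S F u"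
    using assms(6) unfolding coercive_def by blast
  obtain C where C: "C > 0"
    "\<And>B \<Omega> :: (real^'n) set. B \<subset>\<subset> \<Omega> \<Longrightarrow> open \<Omega> \<Longrightarrow> bounded B \<Longrightarrow>
      \<exists>h\<^sub>0>0. \<forall>h. 0 < h \<and> h < h\<^sub>0 \<longrightarrow>
        (\<forall>v\<in>V h. ennreal (discrete_sum S F h v B) \<le> ennreal C * total_variation v \<Omega>)"
    using discrete_sum_total_variation_bound[OF S(1)] by blast
  have S_ne: "S \<noteq> {}" using S(1) by blast
  \<comment> \<open>The upper constant is \<open>C + c\<close>, so that it exceeds the lower
    constant \<open>c\<close> strictly.\<close>
  have bounds: "\<exists>h\<^sub>0>0. \<forall>h. 0 < h \<and> h < h\<^sub>0 \<longrightarrow>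
          (\<forall>u \<in> V_on h \<Omega>. ennreal c * total_variation u A \<le> J S F h u B \<and>
             J S F h u B \<le> ennreal (C + c) * total_variation u \<Omega>)"
    if AB: "open A" "open B" "A \<subset>\<subset> B" "B \<subset>\<subset> \<Omega>" for A B
  proof -
    have "B \<subseteq> \<Omega>" "A \<subseteq> B"
      using AB(3,4) closure_subset unfolding compactly_inside_def by blast+
    then have bB: "bounded B" using assms(8) bounded_subset by blast
    obtain h\<^sub>1 where h1: "h\<^sub>1 > 0" "\<And>h v. 0 < h \<Longrightarrow> h < h\<^sub>1 \<Longrightarrow> v \<in> V h \<Longrightarrow>
        ennreal c * total_variation v A \<le> ennreal (discrete_sum S F h v B)"
      using coercive_total_variation_bound[OF assms(1) S c AB(3,2) bB] by blast
    obtain h\<^sub>2 where h2: "h\<^sub>2 > 0" "\<And>h v. 0 < h \<Longrightarrow> h < h\<^sub>2 \<Longrightarrow> v \<in> V h \<Longrightarrow>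
        ennreal (discrete_sum S F h v B) \<le> ennreal C * total_variation v \<Omega>"
      using C(2)[OF AB(4) assms(7) bB] by blast
    show ?thesis
    proof (intro exI[of _ "min h\<^sub>1 h\<^sub>2"] conjI allI impI ballI)
      show "min h\<^sub>1 h\<^sub>2 > 0" using h1 h2 by simp
      fix h u assume h': "0 < h \<and> h < min h\<^sub>1 h\<^sub>2" and u: "u \<in> V_on h \<Omega>"
      then have h: "0 < h" "h < h\<^sub>1" "h < h\<^sub>2" by auto
      \<comment> \<open>\<open>u\<close> agrees with a function of \<open>V h\<close> only on
        \<open>\<Omega>\<close>. Neither \<open>J\<close> on \<open>B\<close> nor the two total
        variations see values outside \<open>\<Omega>\<close>.\<close>
      obtain v where v: "v \<in> V h" "\<And>x. x \<in> \<Omega> \<Longrightarrow> u x = v x"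
        using u unfolding V_on_def by blast
      have tv: "total_variation u A = total_variation v A" "total_variation u \<Omega> = total_variation v \<Omega>"
        using v(2) \<open>A \<subseteq> B\<close> \<open>B \<subseteq> \<Omega>\<close> by (auto intro!: total_variation_cong)
      have "v \<in> V_on h B" using v(1) unfolding V_on_def by blast
      moreover have "ae_eq_on B u v"
        using v(2) \<open>B \<subseteq> \<Omega>\<close> unfolding ae_eq_on_def by (auto intro!: AE_I2)
      ultimately have J: "J S F h u B = ennreal (discrete_sum S F h v B)"
        by (rule J_eq_discrete_sum[OF h(1) AB(2)])
      show "ennreal c * total_variation u A \<le> J S F h u B"
        unfolding tv J by (rule h1(2)[OF h(1,2) v(1)])
      have "ennreal C * total_variation v \<Omega> \<le> ennreal (C + c) * total_variation v \<Omega>"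
        using c(1) by (intro mult_right_mono ennreal_leI) auto
      then show "J S F h u B \<le> ennreal (C + c) * total_variation u \<Omega>"
        unfolding tv J using h2(2)[OF h(1,3) v(1)] by (rule order.trans[rotated])
    qed
  qed
  show ?thesis
  proof (intro conjI allI impI)
    fix h :: real assume h: "h > 0"
    show "convex_L1 \<Omega> (\<lambda>u. J S F h u \<Omega>)" by (rule J_convex[OF S_ne h assms(7)])
    show "(\<lambda>u. J S F h u \<Omega>) \<in> GC \<Omega>" by (rule J_GC[OF S_ne h assms(7)])
  next
    show "\<exists>C\<^sub>1 C\<^sub>2 :: real. 0 < C\<^sub>1 \<and> C\<^sub>1 < C\<^sub>2 \<and>
      (\<forall>A B. open A \<and> open B \<and> A \<subset>\<subset> B \<and> B \<subset>\<subset> \<Omega> \<longrightarrow>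
        (\<exists>h\<^sub>0>0. \<forall>h. 0 < h \<and> h < h\<^sub>0 \<longrightarrow>
          (\<forall>u \<in> V_on h \<Omega>. ennreal C\<^sub>1 * total_variation u A \<le> J S F h u B \<and>
             J S F h u B \<le> ennreal C\<^sub>2 * total_variation u \<Omega>)))"
      using bounds c(1) C(1) by (intro exI[of _ c] exI[of _ "C + c"]) auto
  qed
qed

end
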